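(* Let $\mathbf{C}^*_{fg}$ be the category of finitely generated unital C*-algebras and unital *-homomorphisms, and let $\mathbf{C}^*_{fd}$ be the full subcategory of finite dimensional C*-algebras. The assignment $(B,C)\mapsto \mathfrak{M}(B,C)$ on objects, $(f,g)\mapsto\mathfrak{M}(f,g)$ on morphisms (for $f:B_1\to B_2$ in $\mathbf{C}^*_{fg}$ and $g:C_2\to C_1$ in $\mathbf{C}^*_{fd}$) is a covariant functor $$\mathfrak{M}:\mathbf{C}^*_{fg}\times(\mathbf{C}^*_{fd})^{op}\longrightarrow\mathbf{C}^*_{fg}.$$ That is, $\mathfrak{M}(\mathrm{id}_B,\mathrm{id}_C)=\mathrm{id}_{\mathfrak{M}(B,C)}$ for all $B\in\mathbf{C}^*_{fg}$, $C\in\mathbf{C}^*_{fd}$, and for all morphisms $f:B_1\to B_2$, $f':B_2\to B_3$ in $\mathbf{C}^*_{fg}$ and $g:C_2\to C_1$, $g':C_3\to C_2$ in $\mathbf{C}^*_{fd}$, $$\mathfrak{M}(f'f,gg')=\mathfrak{M}(f',g')\,\mathfrak{M}(f,g).$$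
   Context: $\otimes$ denotes the minimal tensor product of C*-algebras. A morphism is a unital *-homomorphism. A quantum family of morphisms from a unital C*-algebra $B$ to a unital C*-algebra $C$ is a pair $(A,\Phi)$ with $A$ a unital C*-algebra and $\Phi:B\to C\otimes A$ a unital *-homomorphism. It is called a quantum family of all morphisms from $B$ to $C$ if for every unital C*-algebra $D$ and every unital *-homomorphism $\Psi:B\to C\otimes D$ there is a unique unital *-homomorphism $\Lambda:A\to D$ with $(\mathrm{id}_C\otimes\Lambda)\Phi=\Psi$. Known fact: for $B$ a finitely generated unital C*-algebra and $C$ a finite dimensional C*-algebra, a quantum family of all morphisms from $B$ to $C$ exists, and its algebra is finitely generated and unital; it is denoted $(\mathfrak{M}(B,C),\mathfrak{P}_{B,C})$, so $\mathfrak{P}_{B,C}:B\to C\otimes\mathfrak{M}(B,C)$. For $f:B_1\to B_2$ in $\mathbf{C}^*_{fg}$ and $g:C_2\to C_1$ in $\mathbf{C}^*_{fd}$, $\mathfrak{M}(f,g):\mathfrak{M}(B_1,C_1)\to\mathfrak{M}(B_2,C_2)$ is the unique morphism such that $$(\mathrm{id}_{C_1}\otimes\mathfrak{M}(f,g))\,\mathfrak{P}_{B_1,C_1}=(g\otimes\mathrm{id}_{\mathfrak{M}(B_2,C_2)})\,\mathfrak{P}_{B_2,C_2}\,f.$$ *)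

theory Defs
  imports "HOL-Analysis.Infinite_Sum" "HOL-Algebra.Module" "HOL-Algebra.Subrings"
begin

section \<open>Unital C*-algebras\<close>

definition complex_ring :: "complex ring" where
  "complex_ring = \<lparr>carrier = UNIV, mult = (*), one = 1, zero = 0, add = (+)\<rparr>"

record 'a cstar = "(complex, 'a) module" +
  star :: "'a \<Rightarrow> 'a"
  cnorm :: "'a \<Rightarrow> real"

text \<open>
  The zero algebra is admitted: it is needed as \<open>C \<otimes> A\<close> when \<open>C\<close> or \<open>A\<close> is zero.
\<close>

locale unital_cstar_algebra = ring A + Module.module complex_ring A for A :: "'a cstar" (structure) +
  assumes smult_mult_left:
      "x \<in> carrier A \<Longrightarrow> y \<in> carrier A \<Longrightarrow> (c \<odot>\<^bsub>A\<^esub> x) \<otimes>\<^bsub>A\<^esub> y = c \<odot>\<^bsub>A\<^esub> (x \<otimes>\<^bsub>A\<^esub> y)"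
    and smult_mult_right:
      "x \<in> carrier A \<Longrightarrow> y \<in> carrier A \<Longrightarrow> x \<otimes>\<^bsub>A\<^esub> (c \<odot>\<^bsub>A\<^esub> y) = c \<odot>\<^bsub>A\<^esub> (x \<otimes>\<^bsub>A\<^esub> y)"
    and star_closed: "x \<in> carrier A \<Longrightarrow> star A x \<in> carrier A"
    and star_star: "x \<in> carrier A \<Longrightarrow> star A (star A x) = x"
    and star_add:
      "x \<in> carrier A \<Longrightarrow> y \<in> carrier A \<Longrightarrow> star A (x \<oplus>\<^bsub>A\<^esub> y) = star A x \<oplus>\<^bsub>A\<^esub> star A y"
    and star_smult: "x \<in> carrier A \<Longrightarrow> star A (c \<odot>\<^bsub>A\<^esub> x) = cnj c \<odot>\<^bsub>A\<^esub> star A x"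
    and star_mult:
      "x \<in> carrier A \<Longrightarrow> y \<in> carrier A \<Longrightarrow> star A (x \<otimes>\<^bsub>A\<^esub> y) = star A y \<otimes>\<^bsub>A\<^esub> star A x"
    and cnorm_nonneg: "x \<in> carrier A \<Longrightarrow> 0 \<le> cnorm A x"
    and cnorm_eq_zero: "x \<in> carrier A \<Longrightarrow> cnorm A x = 0 \<longleftrightarrow> x = \<zero>\<^bsub>A\<^esub>"
    and cnorm_triangle:
      "x \<in> carrier A \<Longrightarrow> y \<in> carrier A \<Longrightarrow> cnorm A (x \<oplus>\<^bsub>A\<^esub> y) \<le> cnorm A x + cnorm A y"
    and cnorm_smult: "x \<in> carrier A \<Longrightarrow> cnorm A (c \<odot>\<^bsub>A\<^esub> x) = cmod c * cnorm A x"
    and cnorm_mult: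
      "x \<in> carrier A \<Longrightarrow> y \<in> carrier A \<Longrightarrow> cnorm A (x \<otimes>\<^bsub>A\<^esub> y) \<le> cnorm A x * cnorm A y"
    and cstar_identity: "x \<in> carrier A \<Longrightarrow> cnorm A (star A x \<otimes>\<^bsub>A\<^esub> x) = (cnorm A x)\<^sup>2"
    and complete:
      "(\<And>n. X n \<in> carrier A) \<Longrightarrow>
       (\<And>e. e > 0 \<Longrightarrow> \<exists>N. \<forall>m\<ge>N. \<forall>n\<ge>N. cnorm A (X m \<ominus>\<^bsub>A\<^esub> X n) < e) \<Longrightarrow>
       \<exists>x\<in>carrier A. (\<lambda>n. cnorm A (X n \<ominus>\<^bsub>A\<^esub> x)) \<longlonglongrightarrow> 0"

text \<open>
  Homomorphisms are extensional functions, so that equality of morphisms is equality of functions;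
  composition is \<open>compose\<close> and the identity of \<open>A\<close> is \<open>\<lambda>x\<in>carrier A. x\<close>.
\<close>

definition unital_star_hom :: "'a cstar \<Rightarrow> 'b cstar \<Rightarrow> ('a \<Rightarrow> 'b) set" where
  "unital_star_hom A B =
    {f \<in> carrier A \<rightarrow>\<^sub>E carrier B. f \<in> ring_hom A B \<and>
       (\<forall>c. \<forall>x\<in>carrier A. f (c \<odot>\<^bsub>A\<^esub> x) = c \<odot>\<^bsub>B\<^esub> f x) \<and>
       (\<forall>x\<in>carrier A. f (star A x) = star B (f x))}"

definition id_hom :: "'a cstar \<Rightarrow> 'a \<Rightarrow> 'a" where
  "id_hom A = (\<lambda>x\<in>carrier A. x)"

definition closed_unital_star_subalgebra :: "'a set \<Rightarrow> 'a cstar \<Rightarrow> bool" where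
  "closed_unital_star_subalgebra N A \<longleftrightarrow>
     subring N A \<and> (\<forall>c. \<forall>x\<in>N. c \<odot>\<^bsub>A\<^esub> x \<in> N) \<and> (\<forall>x\<in>N. star A x \<in> N) \<and>
     (\<forall>X. \<forall>x\<in>carrier A. (\<forall>n. X n \<in> N) \<and> (\<lambda>n. cnorm A (X n \<ominus>\<^bsub>A\<^esub> x)) \<longlonglongrightarrow> 0 \<longrightarrow> x \<in> N)"

definition finitely_generated :: "'a cstar \<Rightarrow> bool" where
  "finitely_generated A \<longleftrightarrow>
     (\<exists>S. finite S \<and> S \<subseteq> carrier A \<and>
        (\<forall>N. closed_unital_star_subalgebra N A \<and> S \<subseteq> N \<longrightarrow> N = carrier A))"

definition finite_dimensional :: "'a cstar \<Rightarrow> bool" where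
  "finite_dimensional A \<longleftrightarrow>
     (\<exists>S. finite S \<and> S \<subseteq> carrier A \<and>
        (\<forall>x\<in>carrier A. \<exists>c. x = (\<Oplus>\<^bsub>A\<^esub>s\<in>S. c s \<odot>\<^bsub>A\<^esub> s)))"

definition cstar_fg :: "'a cstar set" where
  "cstar_fg = {B. unital_cstar_algebra B \<and> finitely_generated B}"

definition cstar_fd :: "'a cstar set" where
  "cstar_fd = {C \<in> cstar_fg. finite_dimensional C}"

section \<open>The Hilbert spaces \<open>\<ell>\<^sup>2(I)\<close> and representations on them\<close>

definition ell2 :: "('i \<Rightarrow> complex) set" where
  "ell2 = {x. (\<lambda>i. (cmod (x i))\<^sup>2) summable_on UNIV}"

definition ell2_norm :: "('i \<Rightarrow> complex) \<Rightarrow> real" where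
  "ell2_norm x = sqrt (\<Sum>\<^sub>\<infinity>i. (cmod (x i))\<^sup>2)"

definition ell2_inner :: "('i \<Rightarrow> complex) \<Rightarrow> ('i \<Rightarrow> complex) \<Rightarrow> complex" where
  "ell2_inner x y = (\<Sum>\<^sub>\<infinity>i. cnj (x i) * y i)"

definition bounded_operator :: "(('i \<Rightarrow> complex) \<Rightarrow> ('i \<Rightarrow> complex)) \<Rightarrow> bool" where
  "bounded_operator T \<longleftrightarrow>
     (\<forall>x\<in>ell2. T x \<in> ell2) \<and>
     (\<forall>x\<in>ell2. \<forall>y\<in>ell2. T (\<lambda>i. x i + y i) = (\<lambda>i. T x i + T y i)) \<and>
     (\<forall>c. \<forall>x\<in>ell2. T (\<lambda>i. c * x i) = (\<lambda>i. c * T x i)) \<and>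
     (\<exists>K. \<forall>x\<in>ell2. ell2_norm (T x) \<le> K * ell2_norm x)"

text \<open>
  A *-representation of \<open>A\<close> on \<open>\<ell>\<^sup>2(I)\<close>, where \<open>I\<close> is the type over which \<open>A\<close> is carried; it may be
  degenerate.  Every cyclic representation of \<open>A\<close> lives on a Hilbert space with a dense subset
  that is an image of \<open>A\<close>, hence is, up to a zero summand, unitarily equivalent to one of this form.
  Therefore suprema over these representations are suprema over all representations.
\<close>

definition representation :: "'a cstar \<Rightarrow> ('a \<Rightarrow> ('a \<Rightarrow> complex) \<Rightarrow> ('a \<Rightarrow> complex)) \<Rightarrow> bool" where
  "representation A \<pi> \<longleftrightarrow>
     (\<forall>a\<in>carrier A. bounded_operator (\<pi> a)) \<and>
     (\<forall>a\<in>carrier A. \<forall>b\<in>carrier A. \<forall>x\<in>ell2. \<pi> (a \<oplus>\<^bsub>A\<^esub> b) x = (\<lambda>i. \<pi> a x i + \<pi> b x i)) \<and>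
     (\<forall>c. \<forall>a\<in>carrier A. \<forall>x\<in>ell2. \<pi> (c \<odot>\<^bsub>A\<^esub> a) x = (\<lambda>i. c * \<pi> a x i)) \<and>
     (\<forall>a\<in>carrier A. \<forall>b\<in>carrier A. \<forall>x\<in>ell2. \<pi> (a \<otimes>\<^bsub>A\<^esub> b) x = \<pi> a (\<pi> b x)) \<and>
     (\<forall>a\<in>carrier A. \<forall>x\<in>ell2. \<forall>y\<in>ell2.
        ell2_inner (\<pi> (star A a) x) y = ell2_inner x (\<pi> a y))"

section \<open>The minimal tensor product\<close>

text \<open>
  A list \<open>[(c\<^sub>1, a\<^sub>1), \<dots>, (c\<^sub>n, a\<^sub>n)]\<close> stands for the element \<open>c\<^sub>1 \<otimes> a\<^sub>1 + \<dots> + c\<^sub>n \<otimes> a\<^sub>n\<close> of the algebraic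
  tensor product.  For vectors, \<open>h \<otimes> k\<close> is realised as \<open>(i, j) \<mapsto> h i * k j\<close> in \<open>\<ell>\<^sup>2(I \<times> J)\<close>, the Hilbert
  space tensor product of \<open>\<ell>\<^sup>2(I)\<close> and \<open>\<ell>\<^sup>2(J)\<close>.
\<close>

definition tensor_vec ::
  "(('i \<Rightarrow> complex) \<times> ('j \<Rightarrow> complex)) list \<Rightarrow> ('i \<times> 'j \<Rightarrow> complex)" where
  "tensor_vec vs = (\<lambda>(i, j). \<Sum>(h, k)\<leftarrow>vs. h i * k j)"

text \<open>
  The spatial (minimal) C*-norm of \<open>t\<close>: the supremum, over all pairs of representations \<open>\<pi>\<close>, \<open>\<rho>\<close>, of
  the operator norm of \<open>(\<pi> \<otimes> \<rho>)(t)\<close>, the latter computed on the dense subspace spanned by the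
  elementary tensors.
\<close>

definition min_norm :: "'c cstar \<Rightarrow> 'a cstar \<Rightarrow> ('c \<times> 'a) list \<Rightarrow> real" where
  "min_norm C A t =
     Sup {ell2_norm (tensor_vec [(\<pi> c h, \<rho> a k). (c, a) \<leftarrow> t, (h, k) \<leftarrow> vs]) | \<pi> \<rho> vs.
            representation C \<pi> \<and> representation A \<rho> \<and> set vs \<subseteq> ell2 \<times> ell2 \<and>
            ell2_norm (tensor_vec vs) \<le> 1}"

definition tensor_smult ::
  "'c cstar \<Rightarrow> complex \<Rightarrow> ('c \<times> 'a) list \<Rightarrow> ('c \<times> 'a) list" where
  "tensor_smult C z t = [(z \<odot>\<^bsub>C\<^esub> c, a). (c, a) \<leftarrow> t]"

definition tensor_mult ::
  "'c cstar \<Rightarrow> 'a cstar \<Rightarrow> ('c \<times> 'a) list \<Rightarrow> ('c \<times> 'a) list \<Rightarrow> ('c \<times> 'a) list" where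
  "tensor_mult C A s t = [(c \<otimes>\<^bsub>C\<^esub> c', a \<otimes>\<^bsub>A\<^esub> a'). (c, a) \<leftarrow> s, (c', a') \<leftarrow> t]"

definition tensor_star :: "'c cstar \<Rightarrow> 'a cstar \<Rightarrow> ('c \<times> 'a) list \<Rightarrow> ('c \<times> 'a) list" where
  "tensor_star C A t = [(star C c, star A a). (c, a) \<leftarrow> t]"

definition tensor_dist :: "'c cstar \<Rightarrow> 'a cstar \<Rightarrow> ('c \<times> 'a) list \<Rightarrow> ('c \<times> 'a) list \<Rightarrow> real" where
  "tensor_dist C A s t = min_norm C A (s @ tensor_smult C (- 1) t)"

text \<open>
  \<open>C \<otimes> A\<close> is the Hausdorff completion of the formal sums with respect to \<open>min_norm\<close>: Cauchy
  sequences modulo null sequences.  No separate quotient by the tensor relations is taken: as the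
  spatial norm is a norm on the algebraic tensor product, two formal sums represent the same
  algebraic tensor exactly if their distance is zero.
\<close>

definition tensor_cauchy :: "'c cstar \<Rightarrow> 'a cstar \<Rightarrow> (nat \<Rightarrow> ('c \<times> 'a) list) set" where
  "tensor_cauchy C A =
     {X. (\<forall>n. set (X n) \<subseteq> carrier C \<times> carrier A) \<and>
         (\<forall>e>0. \<exists>N. \<forall>m\<ge>N. \<forall>n\<ge>N. tensor_dist C A (X m) (X n) < e)}"

definition tensor_rel ::
  "'c cstar \<Rightarrow> 'a cstar \<Rightarrow> ((nat \<Rightarrow> ('c \<times> 'a) list) \<times> (nat \<Rightarrow> ('c \<times> 'a) list)) set" where
  "tensor_rel C A =
     {(X, Y). X \<in> tensor_cauchy C A \<and> Y \<in> tensor_cauchy C A \<and>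
              (\<lambda>n. tensor_dist C A (X n) (Y n)) \<longlonglongrightarrow> 0}"

abbreviation tensor_class ::
  "'c cstar \<Rightarrow> 'a cstar \<Rightarrow> (nat \<Rightarrow> ('c \<times> 'a) list) \<Rightarrow> (nat \<Rightarrow> ('c \<times> 'a) list) set" where
  "tensor_class C A X \<equiv> tensor_rel C A `` {X}"

definition min_tensor :: "'c cstar \<Rightarrow> 'a cstar \<Rightarrow> (nat \<Rightarrow> ('c \<times> 'a) list) set cstar" where
  "min_tensor C A =
     \<lparr>carrier = tensor_cauchy C A // tensor_rel C A,
      mult = (\<lambda>x y. \<Union>X\<in>x. \<Union>Y\<in>y. tensor_class C A (\<lambda>n. tensor_mult C A (X n) (Y n))),
      one = tensor_class C A (\<lambda>n. [(\<one>\<^bsub>C\<^esub>, \<one>\<^bsub>A\<^esub>)]),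
      zero = tensor_class C A (\<lambda>n. []),
      add = (\<lambda>x y. \<Union>X\<in>x. \<Union>Y\<in>y. tensor_class C A (\<lambda>n. X n @ Y n)),
      smult = (\<lambda>z x. \<Union>X\<in>x. tensor_class C A (\<lambda>n. tensor_smult C z (X n))),
      star = (\<lambda>x. \<Union>X\<in>x. tensor_class C A (\<lambda>n. tensor_star C A (X n))),
      cnorm = (\<lambda>x. THE r. \<forall>X\<in>x. (\<lambda>n. min_norm C A (X n)) \<longlonglongrightarrow> r)\<rparr>"

text \<open>
  \<open>g \<otimes> h : C \<otimes> A \<rightarrow> C' \<otimes> A'\<close>, the extension by continuity of \<open>c \<otimes> a \<mapsto> g c \<otimes> h a\<close>.
\<close>

definition tensor_hom ::
  "'c cstar \<Rightarrow> 'a cstar \<Rightarrow> 'd cstar \<Rightarrow> 'b cstar \<Rightarrow> ('c \<Rightarrow> 'd) \<Rightarrow> ('a \<Rightarrow> 'b) \<Rightarrow>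
   (nat \<Rightarrow> ('c \<times> 'a) list) set \<Rightarrow> (nat \<Rightarrow> ('d \<times> 'b) list) set" where
  "tensor_hom C A C' A' g h =
     (\<lambda>x\<in>carrier (min_tensor C A).
        \<Union>X\<in>x. tensor_class C' A' (\<lambda>n. map (map_prod g h) (X n)))"

section \<open>Quantum families of morphisms\<close>

text \<open>
  All algebras, including the test algebras \<open>D\<close>, have their carriers in one type \<open>'u\<close>, which plays the
  role of a universe and is arbitrary.
\<close>

definition quantum_family ::
  "'u cstar \<Rightarrow> 'u cstar \<Rightarrow> 'u cstar \<Rightarrow> ('u \<Rightarrow> (nat \<Rightarrow> ('u \<times> 'u) list) set) \<Rightarrow> bool" where
  "quantum_family B C A \<Phi> \<longleftrightarrow>
     unital_cstar_algebra A \<and> \<Phi> \<in> unital_star_hom B (min_tensor C A)"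

definition quantum_family_of_all_morphisms ::
  "'u cstar \<Rightarrow> 'u cstar \<Rightarrow> 'u cstar \<Rightarrow> ('u \<Rightarrow> (nat \<Rightarrow> ('u \<times> 'u) list) set) \<Rightarrow> bool" where
  "quantum_family_of_all_morphisms B C A \<Phi> \<longleftrightarrow>
     quantum_family B C A \<Phi> \<and>
     (\<forall>D \<Psi>. quantum_family B C D \<Psi> \<longrightarrow>
        (\<exists>!\<Lambda>. \<Lambda> \<in> unital_star_hom A D \<and>
              compose (carrier B) (tensor_hom C A C D (id_hom C) \<Lambda>) \<Phi> = \<Psi>))"

text \<open>
  The morphism \<open>\<MM>(f, g) : \<MM>(B\<^sub>1, C\<^sub>1) \<rightarrow> \<MM>(B\<^sub>2, C\<^sub>2)\<close> for \<open>f : B\<^sub>1 \<rightarrow> B\<^sub>2\<close> and \<open>g : C\<^sub>2 \<rightarrow> C\<^sub>1\<close>, relative to a choice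
  \<open>(M B C, P B C)\<close> of quantum families of all morphisms.
\<close>

definition induced_morphism ::
  "('u cstar \<Rightarrow> 'u cstar \<Rightarrow> 'u cstar) \<Rightarrow>
   ('u cstar \<Rightarrow> 'u cstar \<Rightarrow> 'u \<Rightarrow> (nat \<Rightarrow> ('u \<times> 'u) list) set) \<Rightarrow>
   'u cstar \<Rightarrow> 'u cstar \<Rightarrow> 'u cstar \<Rightarrow> 'u cstar \<Rightarrow> ('u \<Rightarrow> 'u) \<Rightarrow> ('u \<Rightarrow> 'u) \<Rightarrow> ('u \<Rightarrow> 'u)" where
  "induced_morphism M P B\<^sub>1 C\<^sub>1 B\<^sub>2 C\<^sub>2 f g =
     (THE \<Lambda>. \<Lambda> \<in> unital_star_hom (M B\<^sub>1 C\<^sub>1) (M B\<^sub>2 C\<^sub>2) \<and>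
        compose (carrier B\<^sub>1)
          (tensor_hom C\<^sub>1 (M B\<^sub>1 C\<^sub>1) C\<^sub>1 (M B\<^sub>2 C\<^sub>2) (id_hom C\<^sub>1) \<Lambda>) (P B\<^sub>1 C\<^sub>1) =
        compose (carrier B\<^sub>1)
          (tensor_hom C\<^sub>2 (M B\<^sub>2 C\<^sub>2) C\<^sub>1 (M B\<^sub>2 C\<^sub>2) g (id_hom (M B\<^sub>2 C\<^sub>2)))
          (compose (carrier B\<^sub>1) (P B\<^sub>2 C\<^sub>2) f))"

end

theory Submission
  imports Defs "HOL-Analysis.L2_Norm" "HOL-Analysis.Elementary_Metric_Spaces"
begin

text \<open>
  Both functor laws come from the uniqueness half of the universal property.  The composite
  \<open>\<Lambda> = \<MM>(f', g') \<MM>(f, g)\<close> satisfies the equation that characterises \<open>\<MM>(f' f, g g')\<close>, because, writing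
  \<open>P\<^sub>i\<close> for the universal family of \<open>(B\<^sub>i, C\<^sub>i)\<close>,
  \<open>(id \<otimes> \<Lambda>) P\<^sub>1 = (id \<otimes> \<MM>(f', g')) (g \<otimes> id) P\<^sub>2 f = (g \<otimes> id) (id \<otimes> \<MM>(f', g')) P\<^sub>2 f
  = (g \<otimes> id) (g' \<otimes> id) P\<^sub>3 f' f\<close>
  (\<open>induced_morphism_compose\<close>); for identities the equation is trivial.  That \<open>\<MM>(f, g)\<close> exists at all
  is the universal property applied to \<open>(g \<otimes> id) P\<^sub>2 f\<close>.

  The argument rests on the fact that \<open>\<otimes>\<close> is a bifunctor: \<open>g \<otimes> h\<close> is a unital *-homomorphism
  (\<open>tensor_hom_unital_star_hom\<close>) and composition is componentwise (\<open>tensor_hom_compose\<close>).  As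
  elements of \<open>C \<otimes> A\<close> are classes of Cauchy sequences of formal sums, everything is computed on
  representatives once all operations, and \<open>g \<otimes> h\<close>, are known to be compatible with the distance.  For
  \<open>g \<otimes> h\<close> this is contractivity for the spatial norm: representations of the target algebras
  pull back along \<open>g\<close> and \<open>h\<close>, so the supremum defining the norm of the image is taken over a
  smaller set (\<open>min_norm_map\<close>).  For the product it is submultiplicativity, together with the
  boundedness of Cauchy sequences.

  All these comparisons of suprema presuppose that the suprema are finite.  This is the analytic
  part: a representation of a C*-algebra is contractive (\<open>representation_contractive\<close>), and
  \<open>S \<otimes> T\<close> is bounded by the product of the bounds of \<open>S\<close> and \<open>T\<close> (\<open>tensor_vec_map_norm\<close>).
\<close>

section \<open>The spaces \<open>\<ell>\<^sup>2(I)\<close>\<close>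

lemma ell2_zero: "(\<lambda>i. 0) \<in> ell2"
  by (simp add: ell2_def)

lemma ell2_smult: "x \<in> ell2 \<Longrightarrow> (\<lambda>i. c * x i) \<in> ell2"
  by (simp add: ell2_def norm_mult power_mult_distrib summable_on_cmult_right)

lemma ell2_add:
  assumes "x \<in> ell2" "y \<in> ell2"
  shows "(\<lambda>i. x i + y i) \<in> ell2"
proof -
  have "(\<lambda>i. 2 * (cmod (x i))\<^sup>2 + 2 * (cmod (y i))\<^sup>2) summable_on UNIV"
    using assms by (intro summable_on_add summable_on_cmult_right) (simp_all add: ell2_def)
  then have "(\<lambda>i. (cmod (x i + y i))\<^sup>2) summable_on UNIV"
  proof (rule summable_on_comparison_test)
    fix i
    have "(cmod (x i + y i))\<^sup>2 \<le> (cmod (x i) + cmod (y i))\<^sup>2"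
      by (simp add: norm_triangle_ineq power_mono)
    also have "\<dots> \<le> 2 * (cmod (x i))\<^sup>2 + 2 * (cmod (y i))\<^sup>2"
      using sum_squares_bound[of "cmod (x i)" "cmod (y i)"] by (simp add: power2_sum)
    finally show "(cmod (x i + y i))\<^sup>2 \<le> 2 * (cmod (x i))\<^sup>2 + 2 * (cmod (y i))\<^sup>2" .
  qed auto
  then show ?thesis by (simp add: ell2_def)
qed

lemma ell2_norm_nonneg: "0 \<le> ell2_norm x"
  by (simp add: ell2_norm_def infsum_nonneg)

lemma ell2_norm_sq: "(ell2_norm x)\<^sup>2 = (\<Sum>\<^sub>\<infinity>i. (cmod (x i))\<^sup>2)"
  by (simp add: ell2_norm_def infsum_nonneg)

lemma ell2_norm_zero: "ell2_norm (\<lambda>i. 0) = 0"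
  by (simp add: ell2_norm_def)

lemma ell2_norm_smult: "ell2_norm (\<lambda>i. c * x i) = cmod c * ell2_norm x"
proof -
  have "(ell2_norm (\<lambda>i. c * x i))\<^sup>2 = (cmod c * ell2_norm x)\<^sup>2"
    by (simp add: ell2_norm_sq norm_mult power_mult_distrib infsum_cmult_right')
  then show ?thesis
    by (simp add: ell2_norm_nonneg)
qed

lemma L2_set_le_ell2_norm:
  assumes "x \<in> ell2" "finite F"
  shows "L2_set (\<lambda>i. cmod (x i)) F \<le> ell2_norm x"
  unfolding L2_set_def ell2_norm_def using assms
  by (intro real_sqrt_le_mono finite_sum_le_infsum) (auto simp: ell2_def)

text \<open>
  Reduces norm estimates in \<open>\<ell>\<^sup>2(I)\<close> to the inequalities for finite sums.
\<close>

lemma ell2_norm_le: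
  assumes "x \<in> ell2" "\<And>F. finite F \<Longrightarrow> L2_set (\<lambda>i. cmod (x i)) F \<le> K"
  shows "ell2_norm x \<le> K"
proof -
  have K: "0 \<le> K" using assms(2)[of "{}"] by simp
  have "(\<Sum>\<^sub>\<infinity>i. (cmod (x i))\<^sup>2) \<le> K\<^sup>2"
  proof (rule infsum_le_finite_sums)
    show "(\<lambda>i. (cmod (x i))\<^sup>2) summable_on UNIV" using assms by (simp add: ell2_def)
    fix F :: "'a set" assume "finite F"
    then show "(\<Sum>i\<in>F. (cmod (x i))\<^sup>2) \<le> K\<^sup>2"
      using assms(2)[of F] K by (simp add: L2_set_def sqrt_le_D)
  qed
  then show ?thesis using K by (simp add: ell2_norm_def real_le_lsqrt)
qed

lemma ell2_norm_triangle:
  assumes "x \<in> ell2" "y \<in> ell2"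
  shows "ell2_norm (\<lambda>i. x i + y i) \<le> ell2_norm x + ell2_norm y"
proof (rule ell2_norm_le[OF ell2_add[OF assms]])
  fix F :: "'a set" assume F: "finite F"
  have "L2_set (\<lambda>i. cmod (x i + y i)) F \<le> L2_set (\<lambda>i. cmod (x i) + cmod (y i)) F"
    by (intro L2_set_mono) (auto simp: norm_triangle_ineq)
  also have "\<dots> \<le> L2_set (\<lambda>i. cmod (x i)) F + L2_set (\<lambda>i. cmod (y i)) F"
    by (rule L2_set_triangle_ineq)
  also have "\<dots> \<le> ell2_norm x + ell2_norm y"
    using assms F by (intro add_mono L2_set_le_ell2_norm)
  finally show "L2_set (\<lambda>i. cmod (x i + y i)) F \<le> ell2_norm x + ell2_norm y" .
qed

lemma ell2_abs_summable:
  assumes "x \<in> ell2" "y \<in> ell2"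
  shows "(\<lambda>i. cnj (x i) * y i) abs_summable_on UNIV"
proof -
  have "(\<lambda>i. (cmod (x i))\<^sup>2 + (cmod (y i))\<^sup>2) summable_on UNIV"
    using assms by (intro summable_on_add) (simp_all add: ell2_def)
  then show ?thesis
  proof (rule summable_on_comparison_test)
    fix i
    have "cmod (x i) * cmod (y i) \<le> 2 * cmod (x i) * cmod (y i)" by simp
    also have "\<dots> \<le> (cmod (x i))\<^sup>2 + (cmod (y i))\<^sup>2" by (rule sum_squares_bound)
    finally show "cmod (cnj (x i) * y i) \<le> (cmod (x i))\<^sup>2 + (cmod (y i))\<^sup>2" by (simp add: norm_mult)
  qed auto
qed

lemma ell2_summable:
  "x \<in> ell2 \<Longrightarrow> y \<in> ell2 \<Longrightarrow> (\<lambda>i. cnj (x i) * y i) summable_on UNIV"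
  by (rule abs_summable_summable[OF ell2_abs_summable])

lemma ell2_inner_add_left:
  "x \<in> ell2 \<Longrightarrow> y \<in> ell2 \<Longrightarrow> z \<in> ell2 \<Longrightarrow>
    ell2_inner (\<lambda>i. x i + y i) z = ell2_inner x z + ell2_inner y z"
  by (simp add: ell2_inner_def distrib_right infsum_add ell2_summable)

lemma ell2_inner_add_right:
  "x \<in> ell2 \<Longrightarrow> y \<in> ell2 \<Longrightarrow> z \<in> ell2 \<Longrightarrow>
    ell2_inner x (\<lambda>i. y i + z i) = ell2_inner x y + ell2_inner x z"
  by (simp add: ell2_inner_def distrib_left infsum_add ell2_summable)

lemma ell2_inner_smult_left: "ell2_inner (\<lambda>i. c * x i) y = cnj c * ell2_inner x y"
  by (simp add: ell2_inner_def mult.assoc infsum_cmult_right')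

lemma ell2_inner_smult_right: "ell2_inner x (\<lambda>i. c * y i) = c * ell2_inner x y"
  by (simp add: ell2_inner_def mult.left_commute infsum_cmult_right')

lemma ell2_inner_cnj: "cnj (ell2_inner x y) = ell2_inner y x"
  by (simp add: ell2_inner_def mult.commute flip: infsum_cnj)

lemma ell2_inner_self:
  assumes "x \<in> ell2"
  shows "ell2_inner x x = of_real ((ell2_norm x)\<^sup>2)"
proof -
  have "(\<Sum>\<^sub>\<infinity>i. of_real ((cmod (x i))\<^sup>2)) = (of_real (\<Sum>\<^sub>\<infinity>i. (cmod (x i))\<^sup>2) :: complex)"
    using assms by (intro infsumI has_sum_of_real) (simp add: ell2_def has_sum_infsum)
  then show ?thesis
    by (simp add: ell2_inner_def ell2_norm_sq mult.commute flip: complex_norm_square)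
qed

lemma ell2_cauchy_schwarz:
  assumes "x \<in> ell2" "y \<in> ell2"
  shows "cmod (ell2_inner x y) \<le> ell2_norm x * ell2_norm y"
proof -
  have "cmod (ell2_inner x y) \<le> (\<Sum>\<^sub>\<infinity>i. cmod (cnj (x i) * y i))"
    unfolding ell2_inner_def using norm_infsum_bound[OF ell2_abs_summable[OF assms]] .
  also have "\<dots> \<le> ell2_norm x * ell2_norm y"
  proof (rule infsum_le_finite_sums[OF ell2_abs_summable[OF assms]])
    fix F :: "'a set" assume F: "finite F"
    have "(\<Sum>i\<in>F. cmod (cnj (x i) * y i)) = (\<Sum>i\<in>F. \<bar>cmod (x i)\<bar> * \<bar>cmod (y i)\<bar>)"
      by (simp add: norm_mult)
    also have "\<dots> \<le> L2_set (\<lambda>i. cmod (x i)) F * L2_set (\<lambda>i. cmod (y i)) F"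
      by (rule L2_set_mult_ineq)
    also have "\<dots> \<le> ell2_norm x * ell2_norm y"
      using assms F by (intro mult_mono L2_set_le_ell2_norm) (simp_all add: ell2_norm_nonneg)
    finally show "(\<Sum>i\<in>F. cmod (cnj (x i) * y i)) \<le> ell2_norm x * ell2_norm y" .
  qed
  finally show ?thesis .
qed

lemma ell2_norm_sq_combination:
  assumes "x \<in> ell2" "y \<in> ell2"
  shows "(ell2_norm (\<lambda>i. y i + of_real r * x i))\<^sup>2 =
    (ell2_norm y)\<^sup>2 + 2 * r * Re (ell2_inner x y) + r\<^sup>2 * (ell2_norm x)\<^sup>2"
proof -
  have m: "(\<lambda>i. of_real r * x i) \<in> ell2" using assms ell2_smult by blast
  have "complex_of_real ((ell2_norm (\<lambda>i. y i + of_real r * x i))\<^sup>2)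
    = ell2_inner (\<lambda>i. y i + of_real r * x i) (\<lambda>i. y i + of_real r * x i)"
    using ell2_inner_self[OF ell2_add[OF assms(2) m]] by simp
  also have "\<dots> = ell2_inner y y + of_real r * (ell2_inner x y + cnj (ell2_inner x y))
     + of_real r * of_real r * ell2_inner x x"
    using assms m by (simp add: ell2_inner_add_left ell2_inner_add_right ell2_add
      ell2_inner_smult_left ell2_inner_smult_right ell2_inner_cnj algebra_simps)
  also have "\<dots> = of_real ((ell2_norm y)\<^sup>2 + 2 * r * Re (ell2_inner x y) + r\<^sup>2 * (ell2_norm x)\<^sup>2)"
    using assms by (simp add: ell2_inner_self complex_add_cnj power2_eq_square)
  finally show ?thesis using of_real_eq_iff by blast
qed

section \<open>Hilbert space tensor products\<close>

text \<open>
  \<open>\<ell>\<^sup>2(I \<times> J)\<close> is the Hilbert sum of its rows and also of its columns.  An operator acting on one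
  tensor factor acts on each column, or each row, separately, which is what makes
  \<open>tensor_vec_map_norm\<close> work.
\<close>

lemma ell2_slices:
  assumes "v \<in> ell2"
  shows "(\<lambda>i. v (i, j)) \<in> ell2" "(\<lambda>j. v (i, j)) \<in> ell2"
    and "((\<lambda>j. (ell2_norm (\<lambda>i. v (i, j)))\<^sup>2) has_sum (ell2_norm v)\<^sup>2) UNIV"
    and "((\<lambda>i. (ell2_norm (\<lambda>j. v (i, j)))\<^sup>2) has_sum (ell2_norm v)\<^sup>2) UNIV"
proof -
  let ?f = "\<lambda>p. (cmod (v p))\<^sup>2"
  have S: "?f summable_on UNIV \<times> UNIV" using assms by (simp add: ell2_def)
  then have S': "(\<lambda>(j, i). ?f (i, j)) summable_on UNIV \<times> UNIV"
    using summable_on_swap[of ?f UNIV UNIV] by (simp add: case_prod_unfold)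
  have r: "(\<lambda>j. ?f (i, j)) summable_on UNIV" for i
    using summable_on_SigmaD1[where f = "\<lambda>i j. ?f (i,j)" and A=UNIV and B = "\<lambda>_. UNIV"] S
    by (simp add: case_prod_unfold)
  have c: "(\<lambda>i. ?f (i, j)) summable_on UNIV" for j
    using summable_on_SigmaD1[where f = "\<lambda>j i. ?f (i,j)" and A=UNIV and B = "\<lambda>_. UNIV"] S'
    by (simp add: case_prod_unfold)
  show "(\<lambda>i. v (i, j)) \<in> ell2" "(\<lambda>j. v (i, j)) \<in> ell2"
    using r c by (simp_all add: ell2_def)
  have h: "(?f has_sum (ell2_norm v)\<^sup>2) (UNIV \<times> UNIV)"
    using S by (simp add: ell2_norm_sq)
  show "((\<lambda>i. (ell2_norm (\<lambda>j. v (i, j)))\<^sup>2) has_sum (ell2_norm v)\<^sup>2) UNIV"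
    using has_sum_SigmaD[OF h] r by (simp add: ell2_norm_sq)
  have "((\<lambda>(j, i). ?f (i, j)) has_sum (ell2_norm v)\<^sup>2) (UNIV \<times> UNIV)"
    using iffD1[OF has_sum_swap h] .
  from has_sum_SigmaD[OF this] show "((\<lambda>j. (ell2_norm (\<lambda>i. v (i, j)))\<^sup>2) has_sum (ell2_norm v)\<^sup>2) UNIV"
    using c by (simp add: ell2_norm_sq)
qed

lemma ell2_tensor:
  assumes "h \<in> ell2" "k \<in> ell2"
  shows "(\<lambda>(i, j). h i * k j) \<in> ell2"
proof -
  have "(\<lambda>p. (cmod (h (fst p)))\<^sup>2 * (cmod (k (snd p)))\<^sup>2) summable_on UNIV \<times> UNIV"
  proof (rule summable_on_SigmaI)
    show "((\<lambda>y. (cmod (h (fst (x, y))))\<^sup>2 * (cmod (k (snd (x, y))))\<^sup>2) has_sum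
      (cmod (h x))\<^sup>2 * (ell2_norm k)\<^sup>2) UNIV" for x
      using assms by (simp add: ell2_norm_sq ell2_def has_sum_cmult_right)
    show "(\<lambda>x. (cmod (h x))\<^sup>2 * (ell2_norm k)\<^sup>2) summable_on UNIV"
      using assms by (intro summable_on_cmult_left) (simp add: ell2_def)
  qed auto
  then show ?thesis
    by (simp add: ell2_def case_prod_unfold norm_mult power_mult_distrib)
qed

lemma tensor_vec_Nil: "tensor_vec [] = (\<lambda>p. 0)"
  by (auto simp: tensor_vec_def)

lemma tensor_vec_Cons: "tensor_vec ((h, k) # vs) = (\<lambda>p. (case p of (i, j) \<Rightarrow> h i * k j) + tensor_vec vs p)"
  by (auto simp: tensor_vec_def)

lemma tensor_vec_append: "tensor_vec (vs @ ws) = (\<lambda>p. tensor_vec vs p + tensor_vec ws p)"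
  by (auto simp: tensor_vec_def)

lemma tensor_vec_ell2: "set vs \<subseteq> ell2 \<times> ell2 \<Longrightarrow> tensor_vec vs \<in> ell2"
proof (induction vs)
  case (Cons v vs)
  then show ?case by (cases v) (simp add: tensor_vec_Cons ell2_add ell2_tensor)
qed (simp add: tensor_vec_Nil ell2_zero)

lemma ell2_inner_tensor:
  assumes "h \<in> ell2" "k \<in> ell2" "h' \<in> ell2" "k' \<in> ell2"
  shows "ell2_inner (\<lambda>(i, j). h i * k j) (\<lambda>(i, j). h' i * k' j) = ell2_inner h h' * ell2_inner k k'"
proof -
  have "(\<lambda>(i, j). (cnj (h i) * h' i) * (cnj (k j) * k' j)) summable_on UNIV \<times> UNIV"
    using ell2_summable[OF ell2_tensor[OF assms(1,2)] ell2_tensor[OF assms(3,4)]]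
    by (simp add: case_prod_unfold mult_ac)
  from infsum_Sigma_banach[OF this]
  have "(\<Sum>\<^sub>\<infinity>(i, j). (cnj (h i) * h' i) * (cnj (k j) * k' j)) = ell2_inner h h' * ell2_inner k k'"
    by (simp add: ell2_inner_def infsum_cmult_right' infsum_cmult_left')
  then show ?thesis
    by (simp add: ell2_inner_def case_prod_unfold mult_ac)
qed

lemma ell2_inner_zero_left: "ell2_inner (\<lambda>i. 0) x = 0"
  by (simp add: ell2_inner_def)

lemma ell2_inner_zero_right: "ell2_inner x (\<lambda>i. 0) = 0"
  by (simp add: ell2_inner_def)

lemma tensor_adjoint:
  assumes S: "\<And>h. h \<in> ell2 \<Longrightarrow> S h \<in> ell2" "\<And>h. h \<in> ell2 \<Longrightarrow> S' h \<in> ell2"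
      "\<And>h h'. h \<in> ell2 \<Longrightarrow> h' \<in> ell2 \<Longrightarrow> ell2_inner (S' h) h' = ell2_inner h (S h')"
    and T: "\<And>k. k \<in> ell2 \<Longrightarrow> T k \<in> ell2" "\<And>k. k \<in> ell2 \<Longrightarrow> T' k \<in> ell2"
      "\<And>k k'. k \<in> ell2 \<Longrightarrow> k' \<in> ell2 \<Longrightarrow> ell2_inner (T' k) k' = ell2_inner k (T k')"
    and vs: "set vs \<subseteq> ell2 \<times> ell2" and ws: "set ws \<subseteq> ell2 \<times> ell2"
  shows "ell2_inner (tensor_vec (map (map_prod S' T') vs)) (tensor_vec ws) =
    ell2_inner (tensor_vec vs) (tensor_vec (map (map_prod S T) ws))"
proof -
  have st: "set (map (map_prod S T) ws) \<subseteq> ell2 \<times> ell2" if "set ws \<subseteq> ell2 \<times> ell2" for ws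
    using that S(1) T(1) by auto
  have st': "set (map (map_prod S' T') ws) \<subseteq> ell2 \<times> ell2" if "set ws \<subseteq> ell2 \<times> ell2" for ws
    using that S(2) T(2) by auto
  have 1: "ell2_inner (\<lambda>(i, j). S' h i * T' k j) (tensor_vec ws) =
    ell2_inner (\<lambda>(i, j). h i * k j) (tensor_vec (map (map_prod S T) ws))"
    if "h \<in> ell2" "k \<in> ell2" for h k
    using ws
  proof (induction ws)
    case (Cons w ws)
    obtain h' k' where w: "w = (h', k')" by (cases w)
    then show ?case using Cons that S T st[of ws]
      by (simp add: tensor_vec_Cons ell2_inner_add_right ell2_tensor tensor_vec_ell2 ell2_inner_tensor)
  qed (simp add: tensor_vec_Nil ell2_inner_zero_right)
  show ?thesis using vs
  proof (induction vs)
    case (Cons w vs)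
    obtain h' k' where w: "w = (h', k')" by (cases w)
    then show ?case using Cons 1 S T st[of ws] st'[of vs] ws
      by (simp add: tensor_vec_Cons ell2_inner_add_left ell2_tensor tensor_vec_ell2)
  qed (simp add: tensor_vec_Nil ell2_inner_zero_left)
qed

lemma bounded_operator_closed: "bounded_operator T \<Longrightarrow> x \<in> ell2 \<Longrightarrow> T x \<in> ell2"
  by (simp add: bounded_operator_def)

lemma bounded_operator_add:
  "bounded_operator T \<Longrightarrow> x \<in> ell2 \<Longrightarrow> y \<in> ell2 \<Longrightarrow> T (\<lambda>i. x i + y i) = (\<lambda>i. T x i + T y i)"
  by (simp add: bounded_operator_def)

lemma bounded_operator_smult:
  "bounded_operator T \<Longrightarrow> x \<in> ell2 \<Longrightarrow> T (\<lambda>i. c * x i) = (\<lambda>i. c * T x i)"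
  by (simp add: bounded_operator_def)

lemma bounded_operator_zero: "bounded_operator T \<Longrightarrow> T (\<lambda>i. 0) = (\<lambda>i. 0)"
  using bounded_operator_smult[of T "\<lambda>i. 0" 0] by (simp add: ell2_zero)

lemma tensor_vec_map_left:
  assumes "bounded_operator S" "set vs \<subseteq> ell2 \<times> ell2"
  shows "(\<lambda>i. tensor_vec (map (map_prod S id) vs) (i, j)) = S (\<lambda>i. tensor_vec vs (i, j))"
  using assms(2)
proof (induction vs)
  case (Cons w vs)
  obtain h k where w: "w = (h, k)" by (cases w)
  have "(\<lambda>i. h i * k j + tensor_vec vs (i, j)) = (\<lambda>i. k j * h i + tensor_vec vs (i, j))"
    by (simp add: mult.commute)
  moreover have "S (\<lambda>i. k j * h i + tensor_vec vs (i, j)) = (\<lambda>i. k j * S h i + S (\<lambda>i. tensor_vec vs (i, j)) i)"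
    using Cons.prems w assms(1) ell2_slices(1)[OF tensor_vec_ell2[of vs]] ell2_smult[of h "k j"]
    by (simp add: bounded_operator_add[of S "\<lambda>i. k j * h i"] bounded_operator_smult)
  ultimately show ?case using Cons w by (auto simp: tensor_vec_Cons fun_eq_iff mult.commute)
qed (simp add: tensor_vec_Nil bounded_operator_zero[OF assms(1)])

lemma tensor_vec_map_right:
  assumes "bounded_operator T" "set vs \<subseteq> ell2 \<times> ell2"
  shows "(\<lambda>j. tensor_vec (map (map_prod id T) vs) (i, j)) = T (\<lambda>j. tensor_vec vs (i, j))"
  using assms(2)
proof (induction vs)
  case (Cons w vs)
  obtain h k where w: "w = (h, k)" by (cases w)
  have "T (\<lambda>j. h i * k j + tensor_vec vs (i, j)) = (\<lambda>j. h i * T k j + T (\<lambda>j. tensor_vec vs (i, j)) j)"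
    using Cons.prems w assms(1) ell2_slices(2)[OF tensor_vec_ell2[of vs]] ell2_smult[of k "h i"]
    by (simp add: bounded_operator_add[of T "\<lambda>j. h i * k j"] bounded_operator_smult)
  then show ?case using Cons w by (auto simp: tensor_vec_Cons fun_eq_iff)
qed (simp add: tensor_vec_Nil bounded_operator_zero[OF assms(1)])

lemma has_sum_sq_le:
  fixes f g :: "'a \<Rightarrow> real"
  assumes "((\<lambda>i. (f i)\<^sup>2) has_sum a\<^sup>2) UNIV" "((\<lambda>i. (g i)\<^sup>2) has_sum b\<^sup>2) UNIV"
    and "\<And>i. f i \<le> K * g i" "\<And>i. 0 \<le> f i" "0 \<le> K" "0 \<le> b"
  shows "a \<le> K * b"
proof -
  have "((\<lambda>i. (K * g i)\<^sup>2) has_sum (K * b)\<^sup>2) UNIV"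
    using has_sum_cmult_right[OF assms(2), of "K\<^sup>2"] by (simp add: power_mult_distrib)
  then have "a\<^sup>2 \<le> (K * b)\<^sup>2"
    by (rule has_sum_mono[OF assms(1)]) (simp add: assms power_mono)
  then show ?thesis using assms by (auto intro: power2_le_imp_le)
qed

text \<open>
  \<open>S \<otimes> T = (S \<otimes> 1) (1 \<otimes> T)\<close>, and each of the two factors is bounded slice by slice.
\<close>

lemma tensor_vec_map_norm:
  assumes S: "bounded_operator S" "\<And>x. x \<in> ell2 \<Longrightarrow> ell2_norm (S x) \<le> K * ell2_norm x" "0 \<le> K"
    and T: "bounded_operator T" "\<And>x. x \<in> ell2 \<Longrightarrow> ell2_norm (T x) \<le> L * ell2_norm x" "0 \<le> L"
    and vs: "set vs \<subseteq> ell2 \<times> ell2"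
  shows "ell2_norm (tensor_vec (map (map_prod S T) vs)) \<le> K * L * ell2_norm (tensor_vec vs)"
proof -
  let ?ws = "map (map_prod id T) vs" and ?us = "map (map_prod S T) vs"
  have ws: "set ?ws \<subseteq> ell2 \<times> ell2" using vs T(1) by (auto simp: bounded_operator_closed)
  have us: "set ?us \<subseteq> ell2 \<times> ell2" using vs S(1) T(1) by (auto simp: bounded_operator_closed)
  have u: "?us = map (map_prod S id) ?ws" by auto
  have "ell2_norm (tensor_vec ?us) \<le> K * ell2_norm (tensor_vec ?ws)"
    by (rule has_sum_sq_le[OF ell2_slices(3)[OF tensor_vec_ell2[OF us]] ell2_slices(3)[OF tensor_vec_ell2[OF ws]]])
      (use S ws in \<open>auto simp only: u tensor_vec_map_left[OF S(1) ws] ell2_norm_nonneg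
         intro!: ell2_slices(1) tensor_vec_ell2\<close>)
  also have "ell2_norm (tensor_vec ?ws) \<le> L * ell2_norm (tensor_vec vs)"
    by (rule has_sum_sq_le[OF ell2_slices(4)[OF tensor_vec_ell2[OF ws]] ell2_slices(4)[OF tensor_vec_ell2[OF vs]]])
      (use T vs in \<open>auto simp only: tensor_vec_map_right[OF T(1) vs] ell2_norm_nonneg
         intro!: ell2_slices(2) tensor_vec_ell2\<close>)
  finally show ?thesis using S(3) by (simp add: mult_left_mono mult.assoc)
qed

section \<open>Representations of C*-algebras are contractive\<close>

context unital_cstar_algebra begin

lemma complex_ring_simps:
  "carrier complex_ring = UNIV" "\<one>\<^bsub>complex_ring\<^esub> = 1" "\<zero>\<^bsub>complex_ring\<^esub> = 0"
  "x \<oplus>\<^bsub>complex_ring\<^esub> y = x + y" "x \<otimes>\<^bsub>complex_ring\<^esub> y = x * y"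
  by (simp_all add: complex_ring_def)

lemma scale_closed: "x \<in> carrier A \<Longrightarrow> c \<odot> x \<in> carrier A"
  using smult_closed[of c x] by (simp add: complex_ring_simps)

lemma scale_one: "x \<in> carrier A \<Longrightarrow> 1 \<odot> x = x"
  using smult_one[of x] by (simp add: complex_ring_simps)

lemma scale_assoc: "x \<in> carrier A \<Longrightarrow> z \<odot> (w \<odot> x) = (z * w) \<odot> x"
  using smult_assoc1[of z w x] by (simp add: complex_ring_simps)

lemma scale_minus_one:
  assumes "x \<in> carrier A"
  shows "\<ominus> x = (- 1) \<odot> x"
proof -
  have abelian: "abelian_group A" by unfold_locales
  have "(- 1) \<odot> x \<oplus> x = (- 1) \<odot> x \<oplus> 1 \<odot> x" using assms by (simp add: scale_one)
  also have "\<dots> = 0 \<odot> x"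
    using smult_l_distr[of "-1" 1 x] assms by (simp add: complex_ring_simps)
  also have "\<dots> = \<zero>"
    using smult_l_null[of x] assms by (simp add: complex_ring_simps)
  finally show ?thesis
    using abelian_group.minus_equality[OF abelian, of "(- 1) \<odot> x" x] assms
    by (simp add: scale_closed)
qed

lemma cnorm_a_inv: "x \<in> carrier A \<Longrightarrow> cnorm A (\<ominus> x) = cnorm A x"
  by (simp add: scale_minus_one cnorm_smult)

lemma cnorm_diff:
  "x \<in> carrier A \<Longrightarrow> y \<in> carrier A \<Longrightarrow> cnorm A (x \<ominus> y) \<le> cnorm A x + cnorm A y"
  using cnorm_triangle[of x "\<ominus> y"] by (simp add: a_minus_def cnorm_a_inv)

text \<open>
  The element \<open>b\<close> inverts \<open>1 - a\<close> from the left.  It is the fixed point of the contraction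
  \<open>x \<mapsto> 1 + x a\<close>, whose iterates starting at \<open>1\<close> are the partial sums of the Neumann series.
\<close>

lemma neumann_resolvent:
  assumes a: "a \<in> carrier A" and q: "cnorm A a < 1"
  shows "\<exists>b\<in>carrier A. b = \<one> \<oplus> b \<otimes> a"
proof -
  define q where "q = cnorm A a"
  have q0: "0 \<le> q" "q < 1" using assms by (simp_all add: q_def cnorm_nonneg)
  define X where "X = rec_nat \<one> (\<lambda>_ x. \<one> \<oplus> x \<otimes> a)"
  have X0: "X 0 = \<one>" and XS: "X (Suc n) = \<one> \<oplus> X n \<otimes> a" for n by (simp_all add: X_def)
  have Xc: "X n \<in> carrier A" for n by (induction n) (simp_all add: X0 XS a)
  \<comment> \<open>The ball of radius \<open>R\<close> is mapped to itself, as \<open>R\<close> solves \<open>R = \<parallel>1\<parallel> + R q\<close>.\<close>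
  define R where "R = cnorm A \<one> / (1 - q)"
  have R: "cnorm A \<one> + R * q = R" using q0 by (simp add: R_def field_simps)
  have R0: "0 \<le> R" using q0 by (simp add: R_def cnorm_nonneg)
  have XR: "cnorm A (X n) \<le> R" for n
  proof (induction n)
    case 0
    have "cnorm A \<one> \<le> R" using R R0 q0 by (metis add_le_cancel_left add.right_neutral mult_nonneg_nonneg)
    then show ?case by (simp add: X0)
  next
    case (Suc n)
    have "cnorm A (X (Suc n)) \<le> cnorm A \<one> + cnorm A (X n \<otimes> a)"
      unfolding XS using Xc a by (intro cnorm_triangle) simp_all
    also have "\<dots> \<le> cnorm A \<one> + cnorm A (X n) * q"
      unfolding q_def using Xc a by (simp add: cnorm_mult)
    also have "\<dots> \<le> cnorm A \<one> + R * q" using Suc q0 by (simp add: mult_right_mono)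
    finally show ?case using R by simp
  qed
  have step: "X (Suc m) \<ominus> X (Suc n) = (X m \<ominus> X n) \<otimes> a" for m n
    using Xc[of m] Xc[of n] a unfolding XS by algebra
  have D: "cnorm A (X (n + k) \<ominus> X n) \<le> q ^ n * (2 * R)" for n k
  proof (induction n)
    case 0
    then show ?case using cnorm_diff[OF Xc[of k] Xc[of 0]] XR[of k] XR[of 0] by simp
  next
    case (Suc n)
    have "cnorm A (X (Suc n + k) \<ominus> X (Suc n)) \<le> cnorm A (X (n + k) \<ominus> X n) * q"
      unfolding add_Suc step q_def using Xc a by (intro cnorm_mult) simp_all
    also have "\<dots> \<le> (q ^ n * (2 * R)) * q" using Suc q0 by (simp add: mult_right_mono)
    finally show ?case by (simp add: mult_ac)
  qed
  have lim0: "(\<lambda>n. q ^ n * (2 * R)) \<longlonglongrightarrow> 0"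
    using tendsto_mult_left_zero[OF LIMSEQ_power_zero[of q], of "2 * R"] q0 by simp
  have sym: "cnorm A (X m \<ominus> X n) = cnorm A (X n \<ominus> X m)" for m n
  proof -
    have "X m \<ominus> X n = \<ominus> (X n \<ominus> X m)" using Xc[of m] Xc[of n] by algebra
    then show ?thesis using Xc by (simp add: cnorm_a_inv)
  qed
  have cauchy: "\<exists>N. \<forall>m\<ge>N. \<forall>n\<ge>N. cnorm A (X m \<ominus> X n) < e" if e: "e > 0" for e
  proof -
    obtain N where N: "\<And>n. n \<ge> N \<Longrightarrow> q ^ n * (2 * R) < e"
      using order_tendstoD(2)[OF lim0 e] by (auto simp: eventually_sequentially)
    have le: "cnorm A (X m \<ominus> X n) < e" if "m \<ge> n" "n \<ge> N" for m n
      using D[of n "m - n"] N[of n] that by simp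
    have "cnorm A (X m \<ominus> X n) < e" if "m \<ge> N" "n \<ge> N" for m n
      using le[of m n] le[of n m] sym[of m n] that by (cases "m \<ge> n") auto
    then show ?thesis by blast
  qed
  obtain b where b: "b \<in> carrier A" and lim: "(\<lambda>n. cnorm A (X n \<ominus> b)) \<longlonglongrightarrow> 0"
    using complete[OF Xc cauchy] by blast
  let ?d = "b \<ominus> (\<one> \<oplus> b \<otimes> a)"
  have bound: "cnorm A ?d \<le> cnorm A (X (Suc n) \<ominus> b) + cnorm A (X n \<ominus> b) * q" for n
  proof -
    have "?d = (X n \<ominus> b) \<otimes> a \<ominus> (X (Suc n) \<ominus> b)"
      unfolding XS using Xc[of n] a b by algebra
    then have "cnorm A ?d \<le> cnorm A ((X n \<ominus> b) \<otimes> a) + cnorm A (X (Suc n) \<ominus> b)"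
      using Xc a b by (simp add: cnorm_diff)
    also have "cnorm A ((X n \<ominus> b) \<otimes> a) \<le> cnorm A (X n \<ominus> b) * q"
      unfolding q_def using Xc a b by (intro cnorm_mult) simp_all
    finally show ?thesis by simp
  qed
  have "(\<lambda>n. cnorm A (X (Suc n) \<ominus> b) + cnorm A (X n \<ominus> b) * q) \<longlonglongrightarrow> 0 + 0 * q"
    by (intro tendsto_add tendsto_mult_right lim LIMSEQ_Suc[OF lim])
  then have "(\<lambda>n. cnorm A (X (Suc n) \<ominus> b) + cnorm A (X n \<ominus> b) * q) \<longlonglongrightarrow> 0" by simp
  from LIMSEQ_le_const[OF this, of "cnorm A ?d"] bound have "cnorm A ?d \<le> 0" by blast
  then have "?d = \<zero>" using cnorm_nonneg[of ?d] cnorm_eq_zero[of ?d] a b by simp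
  then have "b = \<one> \<oplus> b \<otimes> a" using a b by (simp add: r_right_minus_eq)
  then show ?thesis using b by blast
qed

end

text \<open>
  Let \<open>M\<close> be the supremum of \<open>\<parallel>\<pi>(y) x\<parallel>\<^sup>2\<close> over the unit ball, that is the norm of \<open>\<pi>(y* y)\<close>, and suppose
  that \<open>M > \<parallel>y\<parallel>\<^sup>2 = \<parallel>y* y\<parallel>\<close>.  Then \<open>1 - y* y / M\<close> has a left inverse \<open>b\<close> in the algebra, by the Neumann series.
  On the other hand \<open>M\<close> is an approximate eigenvalue of \<open>\<pi>(y* y)\<close>: for \<open>x\<close> in the unit ball,
  \<open>w = x - \<pi>(y* y) x / M\<close> satisfies \<open>\<parallel>w\<parallel>\<^sup>2 \<le> 1 - \<parallel>\<pi>(y) x\<parallel>\<^sup>2 / M\<close>, which is small when \<open>\<parallel>\<pi>(y) x\<parallel>\<^sup>2\<close> is close to \<open>M\<close>.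
  But \<open>\<pi>(b) w = \<pi>(1) x\<close>, so \<open>\<parallel>\<pi>(y) x\<parallel> = \<parallel>\<pi>(y) \<pi>(b) w\<parallel>\<close> would be small as well.  Quantitatively, if
  \<open>L\<close> bounds \<open>\<pi>(b)\<close>, then \<open>\<parallel>\<pi>(y) x\<parallel>\<^sup>2 \<le> L\<^sup>2 M / (1 + L\<^sup>2)\<close> throughout the unit ball, which contradicts the choice
  of \<open>M\<close>.
\<close>

lemma representation_contractive:
  assumes A: "unital_cstar_algebra A" and \<pi>: "representation A \<pi>"
    and y: "y \<in> carrier A" and x: "x \<in> ell2"
  shows "ell2_norm (\<pi> y x) \<le> cnorm A y * ell2_norm x"
proof -
  interpret unital_cstar_algebra A by (rule A)
  have bo: "bounded_operator (\<pi> a)" if "a \<in> carrier A" for a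
    using \<pi> that by (simp add: representation_def)
  note cl = bounded_operator_closed[OF bo]
  have mult: "\<pi> (a \<otimes>\<^bsub>A\<^esub> b) x = \<pi> a (\<pi> b x)" if "a \<in> carrier A" "b \<in> carrier A" "x \<in> ell2" for a b x
    using \<pi> that by (simp add: representation_def)
  have adj: "ell2_inner (\<pi> (star A a) x) z = ell2_inner x (\<pi> a z)"
    if "a \<in> carrier A" "x \<in> ell2" "z \<in> ell2" for a x z
    using \<pi> that by (simp add: representation_def)
  have bd: "\<exists>K\<ge>0. \<forall>x\<in>ell2. ell2_norm (\<pi> a x) \<le> K * ell2_norm x" if a: "a \<in> carrier A" for a
  proof -
    obtain K where K: "\<forall>x\<in>ell2. ell2_norm (\<pi> a x) \<le> K * ell2_norm x"
      using bo[OF a] by (auto simp: bounded_operator_def)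
    have "ell2_norm (\<pi> a x) \<le> \<bar>K\<bar> * ell2_norm x" if "x \<in> ell2" for x
    proof -
      have "K * ell2_norm x \<le> \<bar>K\<bar> * ell2_norm x" by (simp add: ell2_norm_nonneg mult_right_mono)
      then show ?thesis using K that by force
    qed
    then show ?thesis by (intro exI[of _ "\<bar>K\<bar>"]) auto
  qed
  obtain K where K: "K \<ge> 0" "\<And>x. x \<in> ell2 \<Longrightarrow> ell2_norm (\<pi> y x) \<le> K * ell2_norm x"
    using bd[OF y] by blast
  define U where "U = (\<lambda>x. (ell2_norm (\<pi> y x))\<^sup>2) ` {x \<in> ell2. ell2_norm x \<le> 1}"
  define M where "M = Sup U"
  have bddU: "bdd_above U"
  proof (rule bdd_aboveI)
    fix u assume "u \<in> U"
    then obtain x where x: "x \<in> ell2" "ell2_norm x \<le> 1" "u = (ell2_norm (\<pi> y x))\<^sup>2" by (auto simp: U_def)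
    have "ell2_norm (\<pi> y x) \<le> K" using K(2)[OF x(1)] mult_left_mono[OF x(2) K(1)] by simp
    then show "u \<le> K\<^sup>2" using x by (simp add: ell2_norm_nonneg power_mono)
  qed
  have neU: "U \<noteq> {}" by (auto simp: U_def intro!: exI[of _ "\<lambda>i. 0"] simp: ell2_zero ell2_norm_zero)
  have UM: "(ell2_norm (\<pi> y x))\<^sup>2 \<le> M" if "x \<in> ell2" "ell2_norm x \<le> 1" for x
    unfolding M_def using that by (intro cSup_upper bddU) (auto simp: U_def)
  have M0: "0 \<le> M" using UM[OF ell2_zero] by (simp add: ell2_norm_zero order_trans[OF zero_le_power2])
  have yM: "ell2_norm (\<pi> y z) \<le> sqrt M * ell2_norm z" if z: "z \<in> ell2" for z
  proof (cases "ell2_norm z = 0")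
    case True
    then show ?thesis using K(2)[OF z] by simp
  next
    case False
    let ?n = "ell2_norm z"
    have n: "?n > 0" using False ell2_norm_nonneg[of z] by simp
    let ?w = "\<lambda>i. of_real (1 / ?n) * z i"
    have "ell2_norm ?w = 1" using n by (simp only: ell2_norm_smult norm_of_real) simp
    then have "(ell2_norm (\<pi> y ?w))\<^sup>2 \<le> M" by (intro UM ell2_smult z) simp
    then have "(ell2_norm (\<pi> y z) / ?n)\<^sup>2 \<le> M"
      using n by (simp only: bounded_operator_smult[OF bo[OF y] z] ell2_norm_smult norm_of_real)
        (simp add: divide_simps)
    then have "ell2_norm (\<pi> y z) / ?n \<le> sqrt M" by (rule real_le_rsqrt)
    then show ?thesis using n by (simp add: divide_simps)
  qed
  have sy: "star A y \<in> carrier A" using y by (rule star_closed)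
  \<comment> \<open>The adjoint has the same bound: \<open>\<parallel>u\<parallel>\<^sup>2 = \<langle>z, \<pi>(y) u\<rangle>\<close> for \<open>u = \<pi>(y*) z\<close>.\<close>
  have ysM: "ell2_norm (\<pi> (star A y) z) \<le> sqrt M * ell2_norm z" if z: "z \<in> ell2" for z
  proof -
    let ?u = "\<pi> (star A y) z"
    have u: "?u \<in> ell2" using cl[OF sy z] .
    have "of_real ((ell2_norm ?u)\<^sup>2) = ell2_inner z (\<pi> y ?u)"
      using adj[OF y z u] ell2_inner_self[OF u] by simp
    then have "(ell2_norm ?u)\<^sup>2 = cmod (ell2_inner z (\<pi> y ?u))"
      by (metis abs_of_nonneg norm_of_real zero_le_power2)
    also have "\<dots> \<le> ell2_norm z * ell2_norm (\<pi> y ?u)"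
      using z u cl[OF y] by (intro ell2_cauchy_schwarz) auto
    also have "\<dots> \<le> ell2_norm z * (sqrt M * ell2_norm ?u)"
      using yM[OF u] by (simp add: mult_left_mono ell2_norm_nonneg)
    finally have "ell2_norm ?u * ell2_norm ?u \<le> (sqrt M * ell2_norm z) * ell2_norm ?u"
      by (simp add: power2_eq_square mult_ac)
    then show ?thesis
      using ell2_norm_nonneg[of ?u] ell2_norm_nonneg[of z] M0
      by (cases "ell2_norm ?u = 0") (auto simp: mult_le_cancel_right)
  qed
  have "M \<le> (cnorm A y)\<^sup>2"
  proof (rule ccontr)
    assume "\<not> M \<le> (cnorm A y)\<^sup>2"
    then have My: "(cnorm A y)\<^sup>2 < M" by simp
    then have Mp: "0 < M" by (meson order.strict_trans1 zero_le_power2)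
    define a where "a = star A y \<otimes>\<^bsub>A\<^esub> y"
    define a' where "a' = complex_of_real (1 / M) \<odot>\<^bsub>A\<^esub> a"
    have ac: "a \<in> carrier A" "a' \<in> carrier A" using y sy by (simp_all add: a_def a'_def scale_closed)
    have "cnorm A a' = (cnorm A y)\<^sup>2 / M"
      unfolding a'_def using ac(1) Mp by (simp only: cnorm_smult norm_of_real) (simp add: a_def cstar_identity y)
    then have "cnorm A a' < 1" using My Mp by simp
    then obtain b where b: "b \<in> carrier A" "b = \<one>\<^bsub>A\<^esub> \<oplus>\<^bsub>A\<^esub> b \<otimes>\<^bsub>A\<^esub> a'"
      using neumann_resolvent[OF ac(2)] by blast
    obtain L where L: "L \<ge> 0" "\<And>x. x \<in> ell2 \<Longrightarrow> ell2_norm (\<pi> b x) \<le> L * ell2_norm x"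
      using bd[OF b(1)] by blast
    have s: "(ell2_norm (\<pi> y x))\<^sup>2 \<le> L\<^sup>2 * M / (1 + L\<^sup>2)" if x: "x \<in> ell2" "ell2_norm x \<le> 1" for x
    proof -
      let ?s = "(ell2_norm (\<pi> y x))\<^sup>2"
      define t where "t = \<pi> a x"
      have tc: "t \<in> ell2" using cl ac(1) x(1) by (simp add: t_def)
      have yx: "\<pi> y x \<in> ell2" using cl y x(1) by simp
      have t: "t = \<pi> (star A y) (\<pi> y x)" unfolding t_def a_def using mult[OF sy y x(1)] .
      have "(ell2_norm t)\<^sup>2 \<le> (sqrt M * ell2_norm (\<pi> y x))\<^sup>2"
        unfolding t using ysM[OF yx] by (simp add: ell2_norm_nonneg power_mono)
      then have nt: "(ell2_norm t)\<^sup>2 \<le> M * ?s" using M0 by (simp add: power_mult_distrib)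
      have "ell2_inner t x = of_real ?s"
        unfolding t using adj[OF y yx x(1)] ell2_inner_self[OF yx] by simp
      then have it: "Re (ell2_inner t x) = ?s" by simp
      let ?w = "\<lambda>i. x i + of_real (- 1 / M) * t i"
      have wc: "?w \<in> ell2" using x(1) tc by (intro ell2_add ell2_smult)
      have "(ell2_norm ?w)\<^sup>2 = (ell2_norm x)\<^sup>2 - 2 / M * ?s + (1 / M)\<^sup>2 * (ell2_norm t)\<^sup>2"
        using ell2_norm_sq_combination[OF tc x(1), of "-1/M"] it by (simp add: power_divide)
      also have "\<dots> \<le> 1 - 2 / M * ?s + (1 / M)\<^sup>2 * (M * ?s)"
        using mult_left_mono[OF nt, of "(1 / M)\<^sup>2"] power_le_one[OF ell2_norm_nonneg x(2), of 2] by simp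
      also have "\<dots> = 1 - ?s / M" using Mp by (simp add: field_simps power2_eq_square)
      finally have w: "(ell2_norm ?w)\<^sup>2 \<le> 1 - ?s / M" .
      have pa: "\<pi> a' x = (\<lambda>i. of_real (1 / M) * t i)"
        unfolding a'_def t_def using \<pi> ac(1) x(1) by (simp add: representation_def)
      have "\<pi> b x = \<pi> (\<one>\<^bsub>A\<^esub> \<oplus>\<^bsub>A\<^esub> b \<otimes>\<^bsub>A\<^esub> a') x" using b(2) by simp
      also have "\<dots> = (\<lambda>i. \<pi> \<one>\<^bsub>A\<^esub> x i + \<pi> (b \<otimes>\<^bsub>A\<^esub> a') x i)"
        using \<pi> b(1) ac(2) x(1) by (simp add: representation_def)
      also have "\<pi> (b \<otimes>\<^bsub>A\<^esub> a') x = (\<lambda>i. of_real (1 / M) * \<pi> b t i)"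
        unfolding mult[OF b(1) ac(2) x(1)] pa by (rule bounded_operator_smult[OF bo[OF b(1)] tc])
      finally have bx: "\<pi> b x = (\<lambda>i. \<pi> \<one>\<^bsub>A\<^esub> x i + of_real (1 / M) * \<pi> b t i)" .
      have "\<pi> b ?w = (\<lambda>i. \<pi> b x i + of_real (- 1 / M) * \<pi> b t i)"
        using bounded_operator_add[OF bo[OF b(1)] x(1) ell2_smult[OF tc, of "of_real (- 1 / M)"]]
          bounded_operator_smult[OF bo[OF b(1)] tc] by (simp only:)
      then have bw: "\<pi> b ?w = \<pi> \<one>\<^bsub>A\<^esub> x" by (simp add: bx)
      have "\<pi> y x = \<pi> y (\<pi> b ?w)" unfolding bw using mult[of y "\<one>\<^bsub>A\<^esub>" x] y x(1) by simp
      then have "ell2_norm (\<pi> y x) \<le> sqrt M * ell2_norm (\<pi> b ?w)"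
        using yM[OF cl[OF b(1) wc]] by simp
      also have "\<dots> \<le> sqrt M * (L * ell2_norm ?w)"
        using L(2)[OF wc] M0 by (intro mult_left_mono) simp_all
      finally have "?s \<le> (sqrt M * (L * ell2_norm ?w))\<^sup>2" by (simp add: ell2_norm_nonneg power_mono)
      also have "\<dots> = M * L\<^sup>2 * (ell2_norm ?w)\<^sup>2" using M0 by (simp add: power_mult_distrib)
      also have "\<dots> \<le> M * L\<^sup>2 * (1 - ?s / M)" using w M0 by (intro mult_left_mono) simp_all
      also have "\<dots> = L\<^sup>2 * M - L\<^sup>2 * ?s" using Mp by (simp add: field_simps)
      finally have "?s * (1 + L\<^sup>2) \<le> L\<^sup>2 * M" by (simp add: algebra_simps)
      then show ?thesis by (simp add: pos_le_divide_eq add_pos_nonneg)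
    qed
    have "M \<le> L\<^sup>2 * M / (1 + L\<^sup>2)"
      unfolding M_def using neU s by (intro cSup_least) (auto simp: U_def M_def)
    then have "M * (1 + L\<^sup>2) \<le> L\<^sup>2 * M" by (simp add: pos_le_divide_eq add_pos_nonneg)
    then show False using Mp by (simp add: algebra_simps)
  qed
  then have "sqrt M \<le> cnorm A y" using cnorm_nonneg[OF y] by (simp add: real_le_lsqrt)
  then show ?thesis using yM[OF x] ell2_norm_nonneg[of x] by (meson mult_right_mono order_trans)
qed

section \<open>The spatial norm on formal sums\<close>

text \<open>
  \<open>(\<pi> \<otimes> \<rho>)(t)\<close> on formal sums of elementary tensors, as in the definition of \<open>min_norm\<close>.  It
  produces a list again, so that the action of a product is an iterated action.
\<close>

definition tensor_action ::
  "('c \<Rightarrow> ('i \<Rightarrow> complex) \<Rightarrow> 'i \<Rightarrow> complex) \<Rightarrow> ('a \<Rightarrow> ('j \<Rightarrow> complex) \<Rightarrow> 'j \<Rightarrow> complex) \<Rightarrow>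
   ('c \<times> 'a) list \<Rightarrow> (('i \<Rightarrow> complex) \<times> ('j \<Rightarrow> complex)) list \<Rightarrow>
   (('i \<Rightarrow> complex) \<times> ('j \<Rightarrow> complex)) list" where
  "tensor_action \<pi> \<rho> t vs = [(\<pi> c h, \<rho> a k). (c, a) \<leftarrow> t, (h, k) \<leftarrow> vs]"

lemma tensor_action_Nil: "tensor_action \<pi> \<rho> [] vs = []"
  by (simp add: tensor_action_def)

lemma tensor_action_Cons:
  "tensor_action \<pi> \<rho> ((c, a) # t) vs = map (map_prod (\<pi> c) (\<rho> a)) vs @ tensor_action \<pi> \<rho> t vs"
  by (simp add: tensor_action_def map_prod_def)

lemma tensor_action_append:
  "tensor_action \<pi> \<rho> (s @ t) vs = tensor_action \<pi> \<rho> s vs @ tensor_action \<pi> \<rho> t vs"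
  by (simp add: tensor_action_def)

lemma tensor_action_map:
  "tensor_action \<pi> \<rho> (map (map_prod g h) t) vs = tensor_action (\<pi> \<circ> g) (\<rho> \<circ> h) t vs"
  by (induction t) (auto simp: tensor_action_Nil tensor_action_Cons)

lemma representation_bounded_operator:
  "representation A \<pi> \<Longrightarrow> a \<in> carrier A \<Longrightarrow> bounded_operator (\<pi> a)"
  by (simp add: representation_def)

lemma representation_closed:
  "representation A \<pi> \<Longrightarrow> a \<in> carrier A \<Longrightarrow> x \<in> ell2 \<Longrightarrow> \<pi> a x \<in> ell2"
  by (simp add: representation_def bounded_operator_def)

lemma representation_zero: "representation A (\<lambda>a x i. 0)"
  by (simp add: representation_def bounded_operator_def ell2_zero ell2_norm_zero
      ell2_inner_zero_left ell2_inner_zero_right) (auto intro!: exI[of _ 0])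

lemma tensor_vec_map_scale: "tensor_vec (map (map_prod (\<lambda>x i. z * x i) id) vs) = (\<lambda>p. z * tensor_vec vs p)"
  by (induction vs) (auto simp: tensor_vec_Nil tensor_vec_Cons fun_eq_iff distrib_left)

locale tensor_factors =
  fixes C :: "'c cstar" and A :: "'a cstar"
  assumes C: "unital_cstar_algebra C" and A: "unital_cstar_algebra A"
begin

abbreviation formal :: "('c \<times> 'a) list \<Rightarrow> bool" where
  "formal t \<equiv> set t \<subseteq> carrier C \<times> carrier A"

lemma formal_smult: "formal t \<Longrightarrow> formal (tensor_smult C z t)"
  by (auto simp: tensor_smult_def unital_cstar_algebra.scale_closed[OF C])

lemma C_ring: "ring C" and A_ring: "ring A"
  using C A by (simp_all add: unital_cstar_algebra_def)

lemma formal_mult: "formal s \<Longrightarrow> formal t \<Longrightarrow> formal (tensor_mult C A s t)"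
  by (fastforce simp: tensor_mult_def intro!: monoid.m_closed ring.is_monoid C_ring A_ring)

lemma formal_star: "formal t \<Longrightarrow> formal (tensor_star C A t)"
  by (auto simp: tensor_star_def unital_cstar_algebra.star_closed[OF C] unital_cstar_algebra.star_closed[OF A])

lemma formal_diff: "formal s \<Longrightarrow> formal t \<Longrightarrow> formal (s @ tensor_smult C z t)"
  using formal_smult[of t z] by simp

lemma tensor_smult_append: "tensor_smult C z (s @ t) = tensor_smult C z s @ tensor_smult C z t"
  by (simp add: tensor_smult_def)

lemma tensor_smult_smult:
  "formal t \<Longrightarrow> tensor_smult C z (tensor_smult C w t) = tensor_smult C (z * w) t"
  using unital_cstar_algebra.scale_assoc[OF C] by (auto simp: tensor_smult_def)

lemma tensor_mult_append_left: "tensor_mult C A (s @ s') t = tensor_mult C A s t @ tensor_mult C A s' t"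
  by (simp add: tensor_mult_def)

lemma tensor_mult_smult_left:
  "formal s \<Longrightarrow> formal t \<Longrightarrow> tensor_mult C A (tensor_smult C z s) t = tensor_smult C z (tensor_mult C A s t)"
proof (induction s)
  case (Cons x s)
  then show ?case using unital_cstar_algebra.smult_mult_left[OF C]
    by (cases x) (auto simp: tensor_mult_def tensor_smult_def)
qed (simp add: tensor_mult_def tensor_smult_def)

lemma tensor_mult_smult_right:
  "formal s \<Longrightarrow> formal t \<Longrightarrow> tensor_mult C A s (tensor_smult C z t) = tensor_smult C z (tensor_mult C A s t)"
proof (induction s)
  case (Cons x s)
  then show ?case using unital_cstar_algebra.smult_mult_right[OF C]
    by (cases x) (auto simp: tensor_mult_def tensor_smult_def)
qed (simp add: tensor_mult_def tensor_smult_def)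

lemma tensor_star_append: "tensor_star C A (s @ t) = tensor_star C A s @ tensor_star C A t"
  by (simp add: tensor_star_def)

lemma tensor_star_smult:
  "formal t \<Longrightarrow> tensor_star C A (tensor_smult C z t) = tensor_smult C (cnj z) (tensor_star C A t)"
  using unital_cstar_algebra.star_smult[OF C] by (auto simp: tensor_star_def tensor_smult_def)

end

text \<open>
  The index types are those of the algebras, as in the representations admitted in \<open>min_norm\<close>.
\<close>

locale tensor_representation = tensor_factors C A for C :: "'c cstar" and A :: "'a cstar" +
  fixes \<pi> :: "'c \<Rightarrow> ('c \<Rightarrow> complex) \<Rightarrow> 'c \<Rightarrow> complex" and \<rho> :: "'a \<Rightarrow> ('a \<Rightarrow> complex) \<Rightarrow> 'a \<Rightarrow> complex"
  assumes \<pi>: "representation C \<pi>" and \<rho>: "representation A \<rho>"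
begin

abbreviation "vectors vs \<equiv> set vs \<subseteq> ell2 \<times> ell2"
abbreviation "act t vs \<equiv> tensor_vec (tensor_action \<pi> \<rho> t vs)"

lemma tensor_action_vectors:
  assumes "formal t" "vectors vs"
  shows "vectors (tensor_action \<pi> \<rho> t vs)"
  using assms
proof (induction t)
  case (Cons x t)
  obtain c a where x: "x = (c, a)" by (cases x)
  then have "vectors (map (map_prod (\<pi> c) (\<rho> a)) vs)"
    using Cons.prems representation_closed[OF \<pi>, of c] representation_closed[OF \<rho>, of a] by auto
  then show ?case using Cons x by (simp add: tensor_action_Cons)
qed (simp add: tensor_action_Nil)

lemma act_ell2: "formal t \<Longrightarrow> vectors vs \<Longrightarrow> act t vs \<in> ell2"
  by (intro tensor_vec_ell2 tensor_action_vectors)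

lemma act_append: "act (s @ t) vs = (\<lambda>p. act s vs p + act t vs p)"
  by (simp add: tensor_action_append tensor_vec_append)

lemma act_smult:
  assumes "formal t" "vectors vs"
  shows "act (tensor_smult C z t) vs = (\<lambda>p. z * act t vs p)"
  using assms(1)
proof (induction t)
  case Nil
  then show ?case by (simp add: tensor_smult_def tensor_action_Nil tensor_vec_Nil)
next
  case (Cons x t)
  obtain c a where x: "x = (c, a)" by (cases x)
  have "map (map_prod (\<pi> (z \<odot>\<^bsub>C\<^esub> c)) (\<rho> a)) vs
    = map (map_prod (\<lambda>x i. z * x i) id) (map (map_prod (\<pi> c) (\<rho> a)) vs)"
  proof -
    have "\<pi> (z \<odot>\<^bsub>C\<^esub> c) h = (\<lambda>i. z * \<pi> c h i)" if "h \<in> ell2" for h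
      using that Cons.prems \<pi> x by (simp add: representation_def)
    then show ?thesis using assms(2) by auto
  qed
  then have "tensor_vec (map (map_prod (\<pi> (z \<odot>\<^bsub>C\<^esub> c)) (\<rho> a)) vs)
    = (\<lambda>p. z * tensor_vec (map (map_prod (\<pi> c) (\<rho> a)) vs) p)"
    by (simp only: tensor_vec_map_scale)
  moreover have "tensor_smult C z (x # t) = (z \<odot>\<^bsub>C\<^esub> c, a) # tensor_smult C z t"
    by (simp add: tensor_smult_def x)
  ultimately show ?case using Cons x
    by (simp add: tensor_action_Cons tensor_vec_append distrib_left)
qed

lemma act_mult:
  assumes "formal s" "formal t" "vectors vs"
  shows "act (tensor_mult C A s t) vs = act s (tensor_action \<pi> \<rho> t vs)"
  using assms(1)
proof (induction s)
  case Nil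
  then show ?case by (simp add: tensor_mult_def tensor_action_Nil)
next
  case (Cons x s)
  obtain c a where x: "x = (c, a)" by (cases x)
  have "tensor_action \<pi> \<rho> (map (\<lambda>(c', a'). (c \<otimes>\<^bsub>C\<^esub> c', a \<otimes>\<^bsub>A\<^esub> a')) t) vs
     = map (map_prod (\<pi> c) (\<rho> a)) (tensor_action \<pi> \<rho> t vs)"
    using assms(2)
  proof (induction t)
    case (Cons y t)
    obtain c' a' where y: "y = (c', a')" by (cases y)
    have c: "c \<in> carrier C" "c' \<in> carrier C" "a \<in> carrier A" "a' \<in> carrier A"
      using Cons.prems \<open>formal (x # s)\<close> x y by auto
    have "\<pi> (c \<otimes>\<^bsub>C\<^esub> c') h = \<pi> c (\<pi> c' h)" "\<rho> (a \<otimes>\<^bsub>A\<^esub> a') k = \<rho> a (\<rho> a' k)"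
      if "h \<in> ell2" "k \<in> ell2" for h k
      using c that \<pi> \<rho> by (simp_all add: representation_def)
    then have "map (map_prod (\<pi> (c \<otimes>\<^bsub>C\<^esub> c')) (\<rho> (a \<otimes>\<^bsub>A\<^esub> a'))) vs =
        map (map_prod (\<pi> c) (\<rho> a)) (map (map_prod (\<pi> c') (\<rho> a')) vs)"
      using assms(3) by auto
    then show ?case using Cons.IH Cons.prems y by (simp add: tensor_action_Cons)
  qed (simp add: tensor_action_Nil)
  moreover have "tensor_mult C A (x # s) t =
      map (\<lambda>(c', a'). (c \<otimes>\<^bsub>C\<^esub> c', a \<otimes>\<^bsub>A\<^esub> a')) t @ tensor_mult C A s t"
    by (simp add: tensor_mult_def x)
  ultimately show ?case using Cons x
    by (simp add: tensor_action_append tensor_vec_append tensor_action_Cons)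
qed

lemma act_mult_append_right:
  "act (tensor_mult C A s (t @ u)) vs =
    (\<lambda>p. act (tensor_mult C A s t) vs p + act (tensor_mult C A s u) vs p)"
proof (induction s)
  case Nil
  then show ?case by (simp add: tensor_mult_def tensor_action_Nil tensor_vec_Nil)
next
  case (Cons x s)
  obtain c a where x: "x = (c, a)" by (cases x)
  have m: "tensor_mult C A (x # s) t =
      map (\<lambda>(c', a'). (c \<otimes>\<^bsub>C\<^esub> c', a \<otimes>\<^bsub>A\<^esub> a')) t @ tensor_mult C A s t" for t
    by (simp add: tensor_mult_def x)
  show ?case using Cons by (simp add: m act_append add_ac)
qed

lemma act_star:
  assumes "formal t" "vectors vs" "vectors ws"
  shows "ell2_inner (act (tensor_star C A t) vs) (tensor_vec ws) = ell2_inner (tensor_vec vs) (act t ws)"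
  using assms(1)
proof (induction t)
  case Nil
  then show ?case by (simp add: tensor_star_def tensor_action_Nil tensor_vec_Nil
        ell2_inner_zero_left ell2_inner_zero_right)
next
  case (Cons x t)
  obtain c a where x: "x = (c, a)" by (cases x)
  have ca: "c \<in> carrier C" "a \<in> carrier A" and t: "formal t" using Cons.prems x by auto
  have s: "tensor_star C A (x # t) = (star C c, star A a) # tensor_star C A t"
    by (simp add: tensor_star_def x)
  have ca': "star C c \<in> carrier C" "star A a \<in> carrier A"
    using ca C A by (simp_all add: unital_cstar_algebra.star_closed)
  have adj: "ell2_inner (tensor_vec (map (map_prod (\<pi> (star C c)) (\<rho> (star A a))) vs)) (tensor_vec ws)
    = ell2_inner (tensor_vec vs) (tensor_vec (map (map_prod (\<pi> c) (\<rho> a)) ws))"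
    using \<pi> \<rho> ca ca' assms(2,3)
    by (intro tensor_adjoint) (simp_all add: representation_closed, simp_all add: representation_def)
  have e: "tensor_vec (map (map_prod (\<pi> d) (\<rho> b)) us) \<in> ell2"
    if "d \<in> carrier C" "b \<in> carrier A" "vectors us" for d b us
    using that act_ell2[of "[(d, b)]" us] by (simp add: tensor_action_Cons tensor_action_Nil)
  show ?case unfolding s unfolding x using Cons.IH[OF t] adj e ca ca' assms t formal_star[OF t]
    by (simp add: tensor_action_Cons tensor_vec_append ell2_inner_add_left ell2_inner_add_right
        act_ell2 tensor_vec_ell2)
qed

text \<open>
  The bound does not depend on the representations; hence the suprema that define \<open>min_norm\<close> are
  finite.
\<close>

lemma act_bound:
  assumes "formal t" "vectors vs"
  shows "ell2_norm (act t vs) \<le> (\<Sum>(c, a)\<leftarrow>t. cnorm C c * cnorm A a) * ell2_norm (tensor_vec vs)"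
  using assms(1)
proof (induction t)
  case Nil
  then show ?case by (simp add: tensor_action_Nil tensor_vec_Nil ell2_norm_zero)
next
  case (Cons x t)
  obtain c a where x: "x = (c, a)" by (cases x)
  have ca: "c \<in> carrier C" "a \<in> carrier A" and t: "formal t" using Cons.prems x by auto
  have 1: "ell2_norm (tensor_vec (map (map_prod (\<pi> c) (\<rho> a)) vs)) \<le> cnorm C c * cnorm A a * ell2_norm (tensor_vec vs)"
    using ca assms(2)
    by (intro tensor_vec_map_norm representation_bounded_operator[OF \<pi>] representation_bounded_operator[OF \<rho>]
       representation_contractive[OF C \<pi>] representation_contractive[OF A \<rho>]
       unital_cstar_algebra.cnorm_nonneg[OF C] unital_cstar_algebra.cnorm_nonneg[OF A])
  have e: "act [(c, a)] vs \<in> ell2" using ca assms(2) by (intro act_ell2) auto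
  have "ell2_norm (act (x # t) vs) \<le> ell2_norm (tensor_vec (map (map_prod (\<pi> c) (\<rho> a)) vs)) + ell2_norm (act t vs)"
    using ell2_norm_triangle[OF e act_ell2[OF t assms(2)]]
    by (simp add: x tensor_action_Cons tensor_action_Nil tensor_vec_append)
  then show ?case using 1 Cons.IH[OF t] by (simp add: x distrib_right)
qed

lemma act_le_min_norm_unit:
  assumes t: "formal t" and vs: "vectors vs" "ell2_norm (tensor_vec vs) \<le> 1"
  shows "ell2_norm (act t vs) \<le> min_norm C A t"
proof -
  let ?S = "\<Sum>(c, a)\<leftarrow>t. cnorm C c * cnorm A a"
  let ?U = "{ell2_norm (tensor_vec (tensor_action \<pi> \<rho> t vs)) | \<pi> \<rho> vs.
            representation C \<pi> \<and> representation A \<rho> \<and> set vs \<subseteq> ell2 \<times> ell2 \<and>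
            ell2_norm (tensor_vec vs) \<le> 1}"
  have U: "min_norm C A t = Sup ?U" unfolding min_norm_def tensor_action_def ..
  have S0: "0 \<le> ?S" using t
    by (intro sum_list_nonneg)
      (auto intro!: mult_nonneg_nonneg unital_cstar_algebra.cnorm_nonneg[OF C] unital_cstar_algebra.cnorm_nonneg[OF A])
  have bdd: "bdd_above ?U"
  proof (rule bdd_aboveI, clarify)
    fix \<pi>' \<rho>' and ws :: "(('c \<Rightarrow> complex) \<times> ('a \<Rightarrow> complex)) list"
    assume *: "representation C \<pi>'" "representation A \<rho>'" "set ws \<subseteq> ell2 \<times> ell2" "ell2_norm (tensor_vec ws) \<le> 1"
    interpret r: tensor_representation C A \<pi>' \<rho>' using * by unfold_locales
    show "ell2_norm (tensor_vec (tensor_action \<pi>' \<rho>' t ws)) \<le> ?S"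
      using r.act_bound[OF t *(3)] mult_left_mono[OF *(4) S0] by simp
  qed
  have "ell2_norm (act t vs) \<in> ?U" using \<pi> \<rho> vs by blast
  then show ?thesis unfolding U by (rule cSup_upper[OF _ bdd])
qed

text \<open>
  Together with \<open>min_norm_le\<close> below, this makes \<open>min_norm\<close> the least common operator bound.  In the case
  of a null vector, homogeneity is of no use, and the inequality comes from \<open>act_bound\<close>.
\<close>

lemma act_le_min_norm:
  assumes t: "formal t" and vs: "vectors vs"
  shows "ell2_norm (act t vs) \<le> min_norm C A t * ell2_norm (tensor_vec vs)"
proof (cases "ell2_norm (tensor_vec vs) = 0")
  case True
  then show ?thesis using act_bound[OF t vs] by simp
next
  case False
  \<comment> \<open>Scaling the first tensor factors scales the vector, so its norm can be made \<open>1\<close>.\<close>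
  let ?n = "ell2_norm (tensor_vec vs)"
  have n: "0 < ?n" using False ell2_norm_nonneg[of "tensor_vec vs"] by simp
  define z where "z = complex_of_real (1 / ?n)"
  have z: "cmod z = 1 / ?n" unfolding z_def norm_of_real using n by simp
  let ?ws = "map (map_prod (\<lambda>x i. z * x i) id) vs"
  have ws: "vectors ?ws" using vs by (auto simp: ell2_smult)
  have "map (map_prod (\<pi> c) (\<rho> a)) ?ws = map (map_prod (\<lambda>x i. z * x i) id) (map (map_prod (\<pi> c) (\<rho> a)) vs)"
    if "c \<in> carrier C" for c a
    using vs bounded_operator_smult[OF representation_bounded_operator[OF \<pi> that]] by auto
  then have "tensor_action \<pi> \<rho> t ?ws = map (map_prod (\<lambda>x i. z * x i) id) (tensor_action \<pi> \<rho> t vs)"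
    using t by (induction t) (auto simp only: tensor_action_Nil tensor_action_Cons map_append list.map
      insert_subset list.set mem_Sigma_iff split_paired_all)
  then have a: "ell2_norm (act t ?ws) = ell2_norm (act t vs) / ?n"
    by (simp add: tensor_vec_map_scale ell2_norm_smult z)
  have "ell2_norm (tensor_vec ?ws) \<le> 1"
    using n by (simp add: tensor_vec_map_scale ell2_norm_smult z)
  then have "ell2_norm (act t ?ws) \<le> min_norm C A t" by (rule act_le_min_norm_unit[OF t ws])
  then show ?thesis using n by (simp add: a divide_simps)
qed

end

context tensor_factors begin

lemma min_norm_le:
  assumes "0 \<le> K"
    and "\<And>\<pi> \<rho> vs. tensor_representation C A \<pi> \<rho> \<Longrightarrow> set vs \<subseteq> ell2 \<times> ell2 \<Longrightarrow>
      ell2_norm (tensor_vec (tensor_action \<pi> \<rho> t vs)) \<le> K * ell2_norm (tensor_vec vs)"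
  shows "min_norm C A t \<le> K"
proof -
  have "ell2_norm (tensor_vec (tensor_action \<pi> \<rho> t vs)) \<le> K"
    if "representation C \<pi>" "representation A \<rho>" "set vs \<subseteq> ell2 \<times> ell2" "ell2_norm (tensor_vec vs) \<le> 1"
    for \<pi> \<rho> vs
  proof -
    have "tensor_representation C A \<pi> \<rho>" using that by unfold_locales
    then show ?thesis using assms(2)[of \<pi> \<rho> vs] that mult_left_mono[OF that(4) assms(1)] by simp
  qed
  moreover have "\<exists>\<pi> \<rho> vs. representation C \<pi> \<and> representation A \<rho> \<and> set vs \<subseteq> ell2 \<times> ell2 \<and>
            ell2_norm (tensor_vec vs) \<le> 1"
    by (intro exI[of _ "\<lambda>a x i. 0"] exI[of _ "[]"])
      (simp add: representation_zero tensor_vec_Nil ell2_norm_zero)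
  ultimately show ?thesis
    unfolding min_norm_def tensor_action_def by (intro cSup_least) blast+
qed

lemma zero_representation: "tensor_representation C A (\<lambda>a x i. 0) (\<lambda>a x i. 0)"
  by unfold_locales (rule representation_zero)+

lemma min_norm_nonneg: "formal t \<Longrightarrow> 0 \<le> min_norm C A t"
  using tensor_representation.act_le_min_norm_unit[OF zero_representation, of t "[]"]
    order_trans[OF ell2_norm_nonneg]
  by (auto simp: tensor_vec_Nil ell2_norm_zero)

text \<open>
  Formal sums such as \<open>s - u\<close> and \<open>(s - t) + (t - u)\<close> differ as lists but act identically.  The symmetry
  of the distance, the triangle inequality and the estimates for sums and products come down to this.
\<close>

lemma min_norm_cong_le:
  assumes "formal t"
    and "\<And>\<pi> \<rho> vs. tensor_representation C A \<pi> \<rho> \<Longrightarrow> set vs \<subseteq> ell2 \<times> ell2 \<Longrightarrow>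
      tensor_vec (tensor_action \<pi> \<rho> s vs) = tensor_vec (tensor_action \<pi> \<rho> t vs)"
  shows "min_norm C A s \<le> min_norm C A t"
  by (rule min_norm_le[OF min_norm_nonneg[OF assms(1)]])
    (simp add: assms tensor_representation.act_le_min_norm)

lemma min_norm_append:
  assumes "formal s" "formal t"
  shows "min_norm C A (s @ t) \<le> min_norm C A s + min_norm C A t"
proof (rule min_norm_le)
  fix \<pi> \<rho> and vs :: "(('c \<Rightarrow> complex) \<times> ('a \<Rightarrow> complex)) list"
  assume "tensor_representation C A \<pi> \<rho>" and vs: "set vs \<subseteq> ell2 \<times> ell2"
  then interpret tensor_representation C A \<pi> \<rho> by simp
  have "ell2_norm (act (s @ t) vs) \<le> ell2_norm (act s vs) + ell2_norm (act t vs)"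
    unfolding act_append using assms vs by (intro ell2_norm_triangle act_ell2)
  then show "ell2_norm (act (s @ t) vs) \<le> (min_norm C A s + min_norm C A t) * ell2_norm (tensor_vec vs)"
    using act_le_min_norm[OF assms(1) vs] act_le_min_norm[OF assms(2) vs] by (simp add: distrib_right)
qed (simp add: min_norm_nonneg assms)

lemma min_norm_smult:
  assumes "formal t"
  shows "min_norm C A (tensor_smult C z t) \<le> cmod z * min_norm C A t"
proof (rule min_norm_le)
  fix \<pi> \<rho> and vs :: "(('c \<Rightarrow> complex) \<times> ('a \<Rightarrow> complex)) list"
  assume "tensor_representation C A \<pi> \<rho>" and vs: "set vs \<subseteq> ell2 \<times> ell2"
  then interpret tensor_representation C A \<pi> \<rho> by simp
  show "ell2_norm (act (tensor_smult C z t) vs) \<le> cmod z * min_norm C A t * ell2_norm (tensor_vec vs)"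
    using mult_left_mono[OF act_le_min_norm[OF assms vs], of "cmod z"]
    by (simp add: act_smult[OF assms vs] ell2_norm_smult mult.assoc)
qed (simp add: min_norm_nonneg assms)

lemma min_norm_mult:
  assumes "formal s" "formal t"
  shows "min_norm C A (tensor_mult C A s t) \<le> min_norm C A s * min_norm C A t"
proof (rule min_norm_le)
  fix \<pi> \<rho> and vs :: "(('c \<Rightarrow> complex) \<times> ('a \<Rightarrow> complex)) list"
  assume "tensor_representation C A \<pi> \<rho>" and vs: "set vs \<subseteq> ell2 \<times> ell2"
  then interpret tensor_representation C A \<pi> \<rho> by simp
  have "ell2_norm (act (tensor_mult C A s t) vs) \<le> min_norm C A s * ell2_norm (act t vs)"
    unfolding act_mult[OF assms vs] using assms vs by (intro act_le_min_norm tensor_action_vectors)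
  also have "\<dots> \<le> min_norm C A s * (min_norm C A t * ell2_norm (tensor_vec vs))"
    using act_le_min_norm[OF assms(2) vs] assms by (intro mult_left_mono min_norm_nonneg)
  finally show "ell2_norm (act (tensor_mult C A s t) vs) \<le> min_norm C A s * min_norm C A t * ell2_norm (tensor_vec vs)"
    by (simp add: mult.assoc)
qed (simp add: min_norm_nonneg assms)

text \<open>
  The usual proof that the adjoint of a bounded operator has the same bound, with \<open>act_star\<close> as the
  adjoint relation.
\<close>

lemma min_norm_star:
  assumes "formal t"
  shows "min_norm C A (tensor_star C A t) \<le> min_norm C A t"
proof (rule min_norm_le)
  fix \<pi> \<rho> and vs :: "(('c \<Rightarrow> complex) \<times> ('a \<Rightarrow> complex)) list"
  assume "tensor_representation C A \<pi> \<rho>" and vs: "set vs \<subseteq> ell2 \<times> ell2"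
  then interpret tensor_representation C A \<pi> \<rho> by simp
  let ?ws = "tensor_action \<pi> \<rho> (tensor_star C A t) vs"
  let ?u = "tensor_vec ?ws"
  have ws: "vectors ?ws" using assms vs by (intro tensor_action_vectors formal_star)
  have u: "?u \<in> ell2" using ws by (rule tensor_vec_ell2)
  have "of_real ((ell2_norm ?u)\<^sup>2) = ell2_inner (tensor_vec vs) (act t ?ws)"
    using act_star[OF assms vs ws] ell2_inner_self[OF u] by simp
  then have "(ell2_norm ?u)\<^sup>2 = cmod (ell2_inner (tensor_vec vs) (act t ?ws))"
    by (metis abs_of_nonneg norm_of_real zero_le_power2)
  also have "\<dots> \<le> ell2_norm (tensor_vec vs) * ell2_norm (act t ?ws)"
    by (intro ell2_cauchy_schwarz tensor_vec_ell2[OF vs] act_ell2[OF assms ws])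
  also have "\<dots> \<le> ell2_norm (tensor_vec vs) * (min_norm C A t * ell2_norm ?u)"
    using act_le_min_norm[OF assms ws] by (intro mult_left_mono ell2_norm_nonneg)
  finally have "ell2_norm ?u * ell2_norm ?u \<le> (min_norm C A t * ell2_norm (tensor_vec vs)) * ell2_norm ?u"
    by (simp add: power2_eq_square mult_ac)
  then show "ell2_norm ?u \<le> min_norm C A t * ell2_norm (tensor_vec vs)"
    using ell2_norm_nonneg[of ?u] ell2_norm_nonneg[of "tensor_vec vs"] min_norm_nonneg[OF assms]
    by (cases "ell2_norm ?u = 0") (auto simp: mult_le_cancel_right)
qed (simp add: min_norm_nonneg assms)

lemma tensor_dist_nonneg: "formal s \<Longrightarrow> formal t \<Longrightarrow> 0 \<le> tensor_dist C A s t"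
  by (simp add: tensor_dist_def min_norm_nonneg formal_smult)

lemma tensor_dist_self:
  assumes "formal t"
  shows "tensor_dist C A t t = 0"
proof -
  have "min_norm C A (t @ tensor_smult C (- 1) t) \<le> 0"
  proof (rule min_norm_le)
    fix \<pi> \<rho> and vs :: "(('c \<Rightarrow> complex) \<times> ('a \<Rightarrow> complex)) list"
    assume "tensor_representation C A \<pi> \<rho>" and vs: "set vs \<subseteq> ell2 \<times> ell2"
    then interpret tensor_representation C A \<pi> \<rho> by simp
    show "ell2_norm (act (t @ tensor_smult C (- 1) t) vs) \<le> 0 * ell2_norm (tensor_vec vs)"
      using assms vs by (simp add: act_append act_smult ell2_norm_zero)
  qed simp
  then show ?thesis using tensor_dist_nonneg[OF assms assms] by (simp add: tensor_dist_def)
qed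

lemma tensor_dist_commute_le:
  assumes "formal s" "formal t"
  shows "tensor_dist C A s t \<le> tensor_dist C A t s"
proof -
  have "min_norm C A (s @ tensor_smult C (- 1) t) \<le> min_norm C A (tensor_smult C (- 1) (t @ tensor_smult C (- 1) s))"
  proof (rule min_norm_cong_le)
    show "formal (tensor_smult C (- 1) (t @ tensor_smult C (- 1) s))"
      using assms by (intro formal_smult formal_diff)
    fix \<pi> \<rho> and vs :: "(('c \<Rightarrow> complex) \<times> ('a \<Rightarrow> complex)) list"
    assume "tensor_representation C A \<pi> \<rho>" and vs: "set vs \<subseteq> ell2 \<times> ell2"
    then interpret tensor_representation C A \<pi> \<rho> by simp
    show "act (s @ tensor_smult C (- 1) t) vs = act (tensor_smult C (- 1) (t @ tensor_smult C (- 1) s)) vs"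
      using assms vs by (simp add: act_append act_smult formal_smult tensor_smult_append)
  qed
  also have "\<dots> \<le> cmod (- 1) * min_norm C A (t @ tensor_smult C (- 1) s)"
    using assms by (intro min_norm_smult formal_diff)
  finally show ?thesis by (simp add: tensor_dist_def)
qed

lemma tensor_dist_commute:
  "formal s \<Longrightarrow> formal t \<Longrightarrow> tensor_dist C A s t = tensor_dist C A t s"
  by (simp add: tensor_dist_commute_le antisym)

lemma tensor_dist_le_sum:
  assumes "formal s" "formal t" "formal u" "formal v"
    and "\<And>\<pi> \<rho> vs p. tensor_representation C A \<pi> \<rho> \<Longrightarrow> set vs \<subseteq> ell2 \<times> ell2 \<Longrightarrow>
      tensor_vec (tensor_action \<pi> \<rho> s vs) p - tensor_vec (tensor_action \<pi> \<rho> t vs) p =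
      tensor_vec (tensor_action \<pi> \<rho> u vs) p + tensor_vec (tensor_action \<pi> \<rho> v vs) p"
  shows "tensor_dist C A s t \<le> min_norm C A u + min_norm C A v"
proof -
  have "min_norm C A (s @ tensor_smult C (- 1) t) \<le> min_norm C A (u @ v)"
  proof (rule min_norm_cong_le)
    show "formal (u @ v)" using assms by simp
    fix \<pi> \<rho> and vs :: "(('c \<Rightarrow> complex) \<times> ('a \<Rightarrow> complex)) list"
    assume r: "tensor_representation C A \<pi> \<rho>" and vs: "set vs \<subseteq> ell2 \<times> ell2"
    then interpret tensor_representation C A \<pi> \<rho> by simp
    show "act (s @ tensor_smult C (- 1) t) vs = act (u @ v) vs"
      using assms(5)[OF r vs] assms(2) vs by (simp add: act_append act_smult)
  qed
  also have "\<dots> \<le> min_norm C A u + min_norm C A v" by (intro min_norm_append assms)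
  finally show ?thesis by (simp add: tensor_dist_def)
qed

lemma act_diff:
  assumes "tensor_representation C A \<pi> \<rho>" "set vs \<subseteq> ell2 \<times> ell2" "formal t"
  shows "tensor_vec (tensor_action \<pi> \<rho> (s @ tensor_smult C (- 1) t) vs) p =
    tensor_vec (tensor_action \<pi> \<rho> s vs) p - tensor_vec (tensor_action \<pi> \<rho> t vs) p"
proof -
  interpret tensor_representation C A \<pi> \<rho> by (rule assms)
  show ?thesis using assms by (simp add: act_append act_smult)
qed

lemma tensor_dist_triangle:
  assumes "formal s" "formal t" "formal u"
  shows "tensor_dist C A s u \<le> tensor_dist C A s t + tensor_dist C A t u"
  unfolding tensor_dist_def[of _ _ s t] tensor_dist_def[of _ _ t u]
  using assms by (intro tensor_dist_le_sum) (simp_all add: formal_smult act_diff)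

lemma tensor_dist_append:
  assumes "formal s" "formal s'" "formal t" "formal t'"
  shows "tensor_dist C A (s @ t) (s' @ t') \<le> tensor_dist C A s s' + tensor_dist C A t t'"
  unfolding tensor_dist_def[of _ _ s s'] tensor_dist_def[of _ _ t t']
  using assms
  by (intro tensor_dist_le_sum) (simp_all add: formal_smult act_diff tensor_representation.act_append tensor_representation.act_smult)

lemma tensor_dist_smult:
  assumes "formal s" "formal t"
  shows "tensor_dist C A (tensor_smult C z s) (tensor_smult C z t) \<le> cmod z * tensor_dist C A s t"
proof -
  have "tensor_smult C z s @ tensor_smult C (- 1) (tensor_smult C z t) =
    tensor_smult C z (s @ tensor_smult C (- 1) t)"
    using assms by (simp add: tensor_smult_append tensor_smult_smult)
  then show ?thesis unfolding tensor_dist_def using assms by (simp only: min_norm_smult formal_diff)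
qed

lemma tensor_dist_star:
  assumes "formal s" "formal t"
  shows "tensor_dist C A (tensor_star C A s) (tensor_star C A t) \<le> tensor_dist C A s t"
proof -
  have "tensor_star C A s @ tensor_smult C (- 1) (tensor_star C A t) =
    tensor_star C A (s @ tensor_smult C (- 1) t)"
    using assms by (simp add: tensor_star_append tensor_star_smult)
  then show ?thesis unfolding tensor_dist_def using assms by (simp only: min_norm_star formal_diff)
qed

text \<open>
  \<open>s t - s' t' = (s - s') t + s' (t - t')\<close>.
\<close>

lemma tensor_dist_mult:
  assumes "formal s" "formal s'" "formal t" "formal t'"
  shows "tensor_dist C A (tensor_mult C A s t) (tensor_mult C A s' t') \<le>
    tensor_dist C A s s' * min_norm C A t + min_norm C A s' * tensor_dist C A t t'"
proof -
  let ?d = "s @ tensor_smult C (- 1) s'" and ?e = "t @ tensor_smult C (- 1) t'"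
  have d: "formal ?d" "formal ?e" using assms by (simp_all add: formal_smult)
  have "tensor_dist C A (tensor_mult C A s t) (tensor_mult C A s' t') \<le>
    min_norm C A (tensor_mult C A ?d t) + min_norm C A (tensor_mult C A s' ?e)"
  proof (rule tensor_dist_le_sum)
    fix \<pi> \<rho> p and vs :: "(('c \<Rightarrow> complex) \<times> ('a \<Rightarrow> complex)) list"
    assume "tensor_representation C A \<pi> \<rho>" and vs: "set vs \<subseteq> ell2 \<times> ell2"
    then interpret tensor_representation C A \<pi> \<rho> by simp
    show "act (tensor_mult C A s t) vs p - act (tensor_mult C A s' t') vs p =
      act (tensor_mult C A ?d t) vs p + act (tensor_mult C A s' ?e) vs p"
      using assms vs by (simp add: tensor_mult_append_left act_append act_mult_append_right
         tensor_mult_smult_left tensor_mult_smult_right act_smult formal_mult)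
  qed (intro formal_mult assms d)+
  also have "\<dots> \<le> min_norm C A ?d * min_norm C A t + min_norm C A s' * min_norm C A ?e"
    using assms d by (intro add_mono min_norm_mult)
  finally show ?thesis by (simp add: tensor_dist_def)
qed

end

section \<open>The completed tensor product\<close>

context tensor_factors begin

lemma min_norm_le_dist:
  assumes "formal s" "formal t"
  shows "min_norm C A s \<le> tensor_dist C A s t + min_norm C A t"
proof -
  have "min_norm C A s \<le> min_norm C A ((s @ tensor_smult C (- 1) t) @ t)"
    using assms by (intro min_norm_cong_le)
      (simp_all add: formal_smult fun_eq_iff tensor_representation.act_append tensor_representation.act_smult
        del: append_assoc)
  also have "\<dots> \<le> tensor_dist C A s t + min_norm C A t"
    unfolding tensor_dist_def using assms by (intro min_norm_append formal_diff)
  finally show ?thesis .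
qed

lemma tensor_cauchy_formal: "X \<in> tensor_cauchy C A \<Longrightarrow> formal (X n)"
  by (simp add: tensor_cauchy_def)

lemma tensor_cauchy_dist:
  "X \<in> tensor_cauchy C A \<Longrightarrow> 0 < e \<Longrightarrow> \<exists>N. \<forall>m\<ge>N. \<forall>n\<ge>N. tensor_dist C A (X m) (X n) < e"
  by (simp add: tensor_cauchy_def)

lemma tensor_cauchy_bounded:
  assumes "X \<in> tensor_cauchy C A"
  shows "\<exists>B\<ge>0. \<forall>n. min_norm C A (X n) \<le> B"
proof -
  note X = tensor_cauchy_formal[OF assms]
  have "Cauchy (\<lambda>n. min_norm C A (X n))"
  proof (rule CauchyI)
    fix e :: real assume "0 < e"
    then obtain N where N: "\<And>m n. m \<ge> N \<Longrightarrow> n \<ge> N \<Longrightarrow> tensor_dist C A (X m) (X n) < e"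
      using tensor_cauchy_dist[OF assms] by blast
    show "\<exists>N. \<forall>m\<ge>N. \<forall>n\<ge>N. norm (min_norm C A (X m) - min_norm C A (X n)) < e"
    proof (intro exI[of _ N] allI impI)
      fix m n assume mn: "m \<ge> N" "n \<ge> N"
      show "norm (min_norm C A (X m) - min_norm C A (X n)) < e"
        using N[OF mn] N[OF mn(2,1)] min_norm_le_dist[OF X X, of m n] min_norm_le_dist[OF X X, of n m]
        by (simp add: abs_less_iff)
    qed
  qed
  then have "Bseq (\<lambda>n. min_norm C A (X n))" by (rule Cauchy_Bseq)
  then obtain B where B: "B > 0" "\<And>n. norm (min_norm C A (X n)) \<le> B" by (auto simp: Bseq_def)
  have "min_norm C A (X n) \<le> B" for n using B(2)[of n] by simp
  then show ?thesis using B(1) less_imp_le by blast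
qed

lemma equiv_tensor_rel: "equiv (tensor_cauchy C A) (tensor_rel C A)"
proof (rule equivI)
  show "tensor_rel C A \<subseteq> tensor_cauchy C A \<times> tensor_cauchy C A" by (auto simp: tensor_rel_def)
  show "refl_on (tensor_cauchy C A) (tensor_rel C A)"
    by (auto simp: refl_on_def tensor_rel_def tensor_dist_self tensor_cauchy_formal)
  show "sym (tensor_rel C A)"
  proof (rule symI)
    fix X Y assume "(X, Y) \<in> tensor_rel C A"
    then show "(Y, X) \<in> tensor_rel C A"
      using tensor_dist_commute[OF tensor_cauchy_formal tensor_cauchy_formal, of X Y]
      by (simp add: tensor_rel_def)
  qed
  show "trans (tensor_rel C A)"
  proof (rule transI)
    fix X Y Z assume XY: "(X, Y) \<in> tensor_rel C A" and YZ: "(Y, Z) \<in> tensor_rel C A"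
    then have XYZ: "X \<in> tensor_cauchy C A" "Y \<in> tensor_cauchy C A" "Z \<in> tensor_cauchy C A"
      and l: "(\<lambda>n. tensor_dist C A (X n) (Y n) + tensor_dist C A (Y n) (Z n)) \<longlonglongrightarrow> 0"
      by (auto simp: tensor_rel_def intro!: tendsto_add_zero)
    note f = XYZ[THEN tensor_cauchy_formal]
    have "(\<lambda>n. tensor_dist C A (X n) (Z n)) \<longlonglongrightarrow> 0"
      using tendsto_sandwich[OF _ _ tendsto_const l]
        tensor_dist_nonneg[OF f(1,3)] tensor_dist_triangle[OF f] by simp
    then show "(X, Z) \<in> tensor_rel C A" using XYZ by (simp add: tensor_rel_def)
  qed
qed

lemma tensor_class_eq: "(X, Y) \<in> tensor_rel C A \<Longrightarrow> tensor_class C A X = tensor_class C A Y"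
  by (rule equiv_class_eq[OF equiv_tensor_rel])

lemma tensor_class_self: "X \<in> tensor_cauchy C A \<Longrightarrow> X \<in> tensor_class C A X"
  by (rule equiv_class_self[OF equiv_tensor_rel])

lemma tensor_relD: "(X, Y) \<in> tensor_rel C A \<Longrightarrow> X \<in> tensor_cauchy C A \<and> Y \<in> tensor_cauchy C A"
  by (simp add: tensor_rel_def)

lemma tensor_class_closed: "X \<in> tensor_cauchy C A \<Longrightarrow> tensor_class C A X \<in> carrier (min_tensor C A)"
  by (simp add: min_tensor_def quotientI)

lemma tensor_carrierE:
  assumes "x \<in> carrier (min_tensor C A)"
  obtains X where "X \<in> tensor_cauchy C A" "x = tensor_class C A X"
  using assms by (auto simp: min_tensor_def elim: quotientE)

lemma constant_cauchy: "formal t \<Longrightarrow> (\<lambda>n. t) \<in> tensor_cauchy C A"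
  by (simp add: tensor_cauchy_def tensor_dist_self)

lemma UN_tensor_class:
  assumes "X \<in> tensor_cauchy C A" "\<And>Y. (X, Y) \<in> tensor_rel C A \<Longrightarrow> f Y = f X"
  shows "(\<Union>Y\<in>tensor_class C A X. f Y) = f X"
  using tensor_class_self[OF assms(1)] assms(2) by blast

text \<open>
  With \<open>dominated_rel\<close>, the common reason why unary and binary operations preserve Cauchy sequences and
  descend to classes.  The unary case has \<open>X = Y\<close>.  The domination is required along the given sequences
  only, because the product is Lipschitz just on bounded sets.
\<close>

lemma dominated_cauchy:
  assumes D: "tensor_factors D E" and X: "X \<in> tensor_cauchy C A" and Y: "Y \<in> tensor_cauchy C A" and K: "0 \<le> K"
    and Z: "\<And>n. set (Z n) \<subseteq> carrier D \<times> carrier E"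
    and le: "\<And>m n. tensor_dist D E (Z m) (Z n) \<le> K * (tensor_dist C A (X m) (X n) + tensor_dist C A (Y m) (Y n))"
  shows "Z \<in> tensor_cauchy D E"
proof -
  have "\<exists>N. \<forall>m\<ge>N. \<forall>n\<ge>N. tensor_dist D E (Z m) (Z n) < e" if e: "e > 0" for e
  proof -
    define d where "d = e / (2 * (K + 1))"
    have d: "d > 0" using e K by (simp add: d_def)
    obtain N1 where N1: "\<And>m n. m \<ge> N1 \<Longrightarrow> n \<ge> N1 \<Longrightarrow> tensor_dist C A (X m) (X n) < d"
      using tensor_cauchy_dist[OF X d] by blast
    obtain N2 where N2: "\<And>m n. m \<ge> N2 \<Longrightarrow> n \<ge> N2 \<Longrightarrow> tensor_dist C A (Y m) (Y n) < d"
      using tensor_cauchy_dist[OF Y d] by blast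
    have "tensor_dist D E (Z m) (Z n) < e" if "m \<ge> max N1 N2" "n \<ge> max N1 N2" for m n
    proof -
      have "tensor_dist D E (Z m) (Z n) \<le> K * (d + d)"
        using that N1[of m n] N2[of m n] K by (intro order_trans[OF le] mult_left_mono add_mono) (simp_all add: less_imp_le)
      also have "\<dots> < (K + 1) * (d + d)" using d by simp
      also have "\<dots> = 2 * (K + 1) * d" by (simp add: algebra_simps)
      also have "\<dots> = e" using K by (simp add: d_def)
      finally show ?thesis .
    qed
    then show ?thesis by blast
  qed
  then show ?thesis using Z by (simp add: tensor_cauchy_def)
qed

lemma dominated_rel:
  assumes D: "tensor_factors D E" and X: "(X, X') \<in> tensor_rel C A" and Y: "(Y, Y') \<in> tensor_rel C A"
    and Z: "Z \<in> tensor_cauchy D E" "Z' \<in> tensor_cauchy D E"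
    and le: "\<And>n. tensor_dist D E (Z n) (Z' n) \<le> K * (tensor_dist C A (X n) (X' n) + tensor_dist C A (Y n) (Y' n))"
  shows "(Z, Z') \<in> tensor_rel D E"
proof -
  have l: "(\<lambda>n. K * (tensor_dist C A (X n) (X' n) + tensor_dist C A (Y n) (Y' n))) \<longlonglongrightarrow> 0"
    using X Y by (auto simp: tensor_rel_def intro!: tendsto_mult_right_zero tendsto_add_zero)
  have "0 \<le> tensor_dist D E (Z n) (Z' n)" for n
    using Z by (intro tensor_factors.tensor_dist_nonneg[OF D] tensor_factors.tensor_cauchy_formal[OF D])
  then have "(\<lambda>n. tensor_dist D E (Z n) (Z' n)) \<longlonglongrightarrow> 0"
    using tendsto_sandwich[OF _ _ tendsto_const l] le by simp
  then show ?thesis using Z by (simp add: tensor_rel_def)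
qed

lemma lipschitz_lift:
  assumes D: "tensor_factors D E" and K: "0 \<le> K"
    and F: "\<And>t. formal t \<Longrightarrow> set (F t) \<subseteq> carrier D \<times> carrier E"
    and le: "\<And>s t. formal s \<Longrightarrow> formal t \<Longrightarrow> tensor_dist D E (F s) (F t) \<le> K * tensor_dist C A s t"
    and X: "X \<in> tensor_cauchy C A"
  shows "(\<lambda>n. F (X n)) \<in> tensor_cauchy D E"
    and "(\<Union>Y\<in>tensor_class C A X. tensor_class D E (\<lambda>n. F (Y n))) = tensor_class D E (\<lambda>n. F (X n))"
proof -
  have le': "tensor_dist D E (F s) (F t) \<le> K * (tensor_dist C A s t + tensor_dist C A s t)"
    if "formal s" "formal t" for s t
    using le[OF that] mult_nonneg_nonneg[OF K tensor_dist_nonneg[OF that]] by (simp add: distrib_left)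
  have c: "(\<lambda>n. F (X n)) \<in> tensor_cauchy D E" if X: "X \<in> tensor_cauchy C A" for X
    by (intro dominated_cauchy[OF D X X K] F le' tensor_cauchy_formal[OF X])
  show "(\<lambda>n. F (X n)) \<in> tensor_cauchy D E" by (rule c[OF X])
  show "(\<Union>Y\<in>tensor_class C A X. tensor_class D E (\<lambda>n. F (Y n))) = tensor_class D E (\<lambda>n. F (X n))"
  proof (rule UN_tensor_class[OF X])
    fix Y assume r: "(X, Y) \<in> tensor_rel C A"
    note Y = tensor_relD[OF r, THEN conjunct2]
    have "((\<lambda>n. F (X n)), (\<lambda>n. F (Y n))) \<in> tensor_rel D E"
      by (intro dominated_rel[OF D r r c[OF X] c[OF Y], where K = K] le' tensor_cauchy_formal[OF X] tensor_cauchy_formal[OF Y])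
    then show "tensor_class D E (\<lambda>n. F (Y n)) = tensor_class D E (\<lambda>n. F (X n))"
      using tensor_factors.tensor_class_eq[OF D] by blast
  qed
qed

lemma tensor_smult_class:
  assumes X: "X \<in> tensor_cauchy C A"
  shows "(\<lambda>n. tensor_smult C z (X n)) \<in> tensor_cauchy C A"
    and "z \<odot>\<^bsub>min_tensor C A\<^esub> tensor_class C A X = tensor_class C A (\<lambda>n. tensor_smult C z (X n))"
  using lipschitz_lift[where F = "tensor_smult C z",
      OF tensor_factors_axioms norm_ge_zero[of z] formal_smult tensor_dist_smult X]
  by (simp_all add: min_tensor_def)

lemma tensor_star_class:
  assumes X: "X \<in> tensor_cauchy C A"
  shows "(\<lambda>n. tensor_star C A (X n)) \<in> tensor_cauchy C A"
    and "star (min_tensor C A) (tensor_class C A X) = tensor_class C A (\<lambda>n. tensor_star C A (X n))"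
proof -
  have le: "tensor_dist C A (tensor_star C A s) (tensor_star C A t) \<le> 1 * tensor_dist C A s t"
    if "formal s" "formal t" for s t using tensor_dist_star[OF that] by simp
  show "(\<lambda>n. tensor_star C A (X n)) \<in> tensor_cauchy C A"
    and "star (min_tensor C A) (tensor_class C A X) = tensor_class C A (\<lambda>n. tensor_star C A (X n))"
    using lipschitz_lift[OF tensor_factors_axioms zero_le_one formal_star le X]
    by (simp_all add: min_tensor_def)
qed

lemma tensor_add_class:
  assumes X: "X \<in> tensor_cauchy C A" and Y: "Y \<in> tensor_cauchy C A"
  shows "(\<lambda>n. X n @ Y n) \<in> tensor_cauchy C A"
    and "tensor_class C A X \<oplus>\<^bsub>min_tensor C A\<^esub> tensor_class C A Y = tensor_class C A (\<lambda>n. X n @ Y n)"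
proof -
  note f = tensor_cauchy_formal
  have c: "(\<lambda>n. X n @ Y n) \<in> tensor_cauchy C A"
    if X: "X \<in> tensor_cauchy C A" and Y: "Y \<in> tensor_cauchy C A" for X Y
    by (rule dominated_cauchy[OF tensor_factors_axioms X Y zero_le_one])
      (use f[OF X] f[OF Y] in \<open>simp_all add: tensor_dist_append\<close>)
  show "(\<lambda>n. X n @ Y n) \<in> tensor_cauchy C A" by (rule c[OF X Y])
  have r: "tensor_class C A (\<lambda>n. X n @ Y n) = tensor_class C A (\<lambda>n. X' n @ Y' n)"
    if X: "(X, X') \<in> tensor_rel C A" and Y: "(Y, Y') \<in> tensor_rel C A" for X X' Y Y'
    by (intro tensor_class_eq dominated_rel[OF tensor_factors_axioms X Y, where K = 1])
      (use tensor_relD[OF X] tensor_relD[OF Y] f in \<open>simp_all add: tensor_dist_append c\<close>)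
  have "tensor_class C A X \<oplus>\<^bsub>min_tensor C A\<^esub> tensor_class C A Y =
     (\<Union>X\<in>tensor_class C A X. \<Union>Y\<in>tensor_class C A Y. tensor_class C A (\<lambda>n. X n @ Y n))"
    by (simp add: min_tensor_def)
  also have "\<dots> = tensor_class C A (\<lambda>n. X n @ Y n)"
    by (intro UN_equiv_class2[OF equiv_tensor_rel equiv_tensor_rel congruent2I'] X Y r)
  finally show "tensor_class C A X \<oplus>\<^bsub>min_tensor C A\<^esub> tensor_class C A Y = tensor_class C A (\<lambda>n. X n @ Y n)" .
qed

lemma tensor_dist_mult_uniform:
  assumes "formal s" "formal s'" "formal t" "formal t'" "min_norm C A t \<le> K" "min_norm C A s' \<le> L" "0 \<le> K" "0 \<le> L"
  shows "tensor_dist C A (tensor_mult C A s t) (tensor_mult C A s' t') \<le>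
    (K + L) * (tensor_dist C A s s' + tensor_dist C A t t')"
proof -
  have "tensor_dist C A (tensor_mult C A s t) (tensor_mult C A s' t') \<le>
    tensor_dist C A s s' * K + L * tensor_dist C A t t'"
    using assms by (intro order_trans[OF tensor_dist_mult] add_mono mult_mono tensor_dist_nonneg order_refl)
       (simp_all add: min_norm_nonneg)
  also have "\<dots> \<le> (K + L) * (tensor_dist C A s s' + tensor_dist C A t t')"
    using assms tensor_dist_nonneg[of s s'] tensor_dist_nonneg[of t t'] by (simp add: algebra_simps)
  finally show ?thesis .
qed

lemma tensor_mult_class:
  assumes X: "X \<in> tensor_cauchy C A" and Y: "Y \<in> tensor_cauchy C A"
  shows "(\<lambda>n. tensor_mult C A (X n) (Y n)) \<in> tensor_cauchy C A"
    and "tensor_class C A X \<otimes>\<^bsub>min_tensor C A\<^esub> tensor_class C A Y =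
      tensor_class C A (\<lambda>n. tensor_mult C A (X n) (Y n))"
proof -
  note f = tensor_cauchy_formal
  have c: "(\<lambda>n. tensor_mult C A (X n) (Y n)) \<in> tensor_cauchy C A"
    if X: "X \<in> tensor_cauchy C A" and Y: "Y \<in> tensor_cauchy C A" for X Y
  proof -
    obtain K where K: "0 \<le> K" "\<And>n. min_norm C A (Y n) \<le> K" using tensor_cauchy_bounded[OF Y] by blast
    obtain L where L: "0 \<le> L" "\<And>n. min_norm C A (X n) \<le> L" using tensor_cauchy_bounded[OF X] by blast
    show ?thesis
      by (rule dominated_cauchy[OF tensor_factors_axioms X Y add_nonneg_nonneg[OF K(1) L(1)]])
        (intro formal_mult tensor_dist_mult_uniform f X Y K L)+
  qed
  show "(\<lambda>n. tensor_mult C A (X n) (Y n)) \<in> tensor_cauchy C A" by (rule c[OF X Y])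
  have r: "tensor_class C A (\<lambda>n. tensor_mult C A (X n) (Y n)) = tensor_class C A (\<lambda>n. tensor_mult C A (X' n) (Y' n))"
    if X: "(X, X') \<in> tensor_rel C A" and Y: "(Y, Y') \<in> tensor_rel C A" for X X' Y Y'
  proof -
    have cs: "X \<in> tensor_cauchy C A" "X' \<in> tensor_cauchy C A" "Y \<in> tensor_cauchy C A" "Y' \<in> tensor_cauchy C A"
      using tensor_relD[OF X] tensor_relD[OF Y] by simp_all
    obtain K where K: "0 \<le> K" "\<And>n. min_norm C A (Y n) \<le> K" using tensor_cauchy_bounded[OF cs(3)] by blast
    obtain L where L: "0 \<le> L" "\<And>n. min_norm C A (X' n) \<le> L" using tensor_cauchy_bounded[OF cs(2)] by blast
    show ?thesis
      by (intro tensor_class_eq dominated_rel[OF tensor_factors_axioms X Y, where K = "K + L"] c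
          tensor_dist_mult_uniform f cs K L)
  qed
  have "tensor_class C A X \<otimes>\<^bsub>min_tensor C A\<^esub> tensor_class C A Y =
     (\<Union>X\<in>tensor_class C A X. \<Union>Y\<in>tensor_class C A Y. tensor_class C A (\<lambda>n. tensor_mult C A (X n) (Y n)))"
    by (simp add: min_tensor_def)
  also have "\<dots> = tensor_class C A (\<lambda>n. tensor_mult C A (X n) (Y n))"
    by (intro UN_equiv_class2[OF equiv_tensor_rel equiv_tensor_rel congruent2I'] X Y r)
  finally show "tensor_class C A X \<otimes>\<^bsub>min_tensor C A\<^esub> tensor_class C A Y =
      tensor_class C A (\<lambda>n. tensor_mult C A (X n) (Y n))" .
qed

end

section \<open>Functoriality of the tensor product\<close>

lemma unital_star_homD:
  assumes "f \<in> unital_star_hom A B"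
  shows "x \<in> carrier A \<Longrightarrow> f x \<in> carrier B"
    and "x \<in> carrier A \<Longrightarrow> y \<in> carrier A \<Longrightarrow> f (x \<oplus>\<^bsub>A\<^esub> y) = f x \<oplus>\<^bsub>B\<^esub> f y"
    and "x \<in> carrier A \<Longrightarrow> y \<in> carrier A \<Longrightarrow> f (x \<otimes>\<^bsub>A\<^esub> y) = f x \<otimes>\<^bsub>B\<^esub> f y"
    and "f \<one>\<^bsub>A\<^esub> = \<one>\<^bsub>B\<^esub>"
    and "x \<in> carrier A \<Longrightarrow> f (c \<odot>\<^bsub>A\<^esub> x) = c \<odot>\<^bsub>B\<^esub> f x"
    and "x \<in> carrier A \<Longrightarrow> f (star A x) = star B (f x)"
    and "f \<in> extensional (carrier A)"
  using assms by (auto simp: unital_star_hom_def ring_hom_def PiE_def)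

lemma unital_star_homI:
  assumes "\<And>x. x \<in> carrier A \<Longrightarrow> f x \<in> carrier B"
    and "\<And>x y. x \<in> carrier A \<Longrightarrow> y \<in> carrier A \<Longrightarrow> f (x \<oplus>\<^bsub>A\<^esub> y) = f x \<oplus>\<^bsub>B\<^esub> f y"
    and "\<And>x y. x \<in> carrier A \<Longrightarrow> y \<in> carrier A \<Longrightarrow> f (x \<otimes>\<^bsub>A\<^esub> y) = f x \<otimes>\<^bsub>B\<^esub> f y"
    and "f \<one>\<^bsub>A\<^esub> = \<one>\<^bsub>B\<^esub>"
    and "\<And>c x. x \<in> carrier A \<Longrightarrow> f (c \<odot>\<^bsub>A\<^esub> x) = c \<odot>\<^bsub>B\<^esub> f x"
    and "\<And>x. x \<in> carrier A \<Longrightarrow> f (star A x) = star B (f x)"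
    and "f \<in> extensional (carrier A)"
  shows "f \<in> unital_star_hom A B"
  using assms by (auto simp: unital_star_hom_def ring_hom_def PiE_def)

lemma unital_cstar_algebra_closed:
  assumes "unital_cstar_algebra A"
  shows "x \<in> carrier A \<Longrightarrow> y \<in> carrier A \<Longrightarrow> x \<oplus>\<^bsub>A\<^esub> y \<in> carrier A"
    and "x \<in> carrier A \<Longrightarrow> y \<in> carrier A \<Longrightarrow> x \<otimes>\<^bsub>A\<^esub> y \<in> carrier A"
    and "\<one>\<^bsub>A\<^esub> \<in> carrier A"
    and "x \<in> carrier A \<Longrightarrow> c \<odot>\<^bsub>A\<^esub> x \<in> carrier A"
    and "x \<in> carrier A \<Longrightarrow> star A x \<in> carrier A"
proof -
  interpret unital_cstar_algebra A by (rule assms)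
  show "x \<in> carrier A \<Longrightarrow> y \<in> carrier A \<Longrightarrow> x \<oplus>\<^bsub>A\<^esub> y \<in> carrier A"
    and "x \<in> carrier A \<Longrightarrow> y \<in> carrier A \<Longrightarrow> x \<otimes>\<^bsub>A\<^esub> y \<in> carrier A"
    and "\<one>\<^bsub>A\<^esub> \<in> carrier A"
    and "x \<in> carrier A \<Longrightarrow> c \<odot>\<^bsub>A\<^esub> x \<in> carrier A"
    and "x \<in> carrier A \<Longrightarrow> star A x \<in> carrier A"
    by (simp_all add: scale_closed star_closed)
qed

lemma unital_star_hom_id:
  assumes "unital_cstar_algebra A"
  shows "id_hom A \<in> unital_star_hom A A"
  using unital_cstar_algebra_closed[OF assms] by (intro unital_star_homI) (auto simp: id_hom_def)

lemma unital_star_hom_compose: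
  assumes A: "unital_cstar_algebra A" and f: "f \<in> unital_star_hom A B" and g: "g \<in> unital_star_hom B D"
  shows "compose (carrier A) g f \<in> unital_star_hom A D"
  using unital_cstar_algebra_closed[OF A] unital_star_homD[OF f] unital_star_homD[OF g]
  by (intro unital_star_homI) (simp_all add: compose_eq)

text \<open>
  The reason why \<open>g \<otimes> h\<close> is contractive.  Source and target algebra share their carrier type, hence
  their representations act on the same Hilbert space.
\<close>

lemma representation_pullback:
  assumes "representation B \<pi>" "g \<in> unital_star_hom A B"
  shows "representation A (\<pi> \<circ> g)"
  using assms(1) unital_star_homD[OF assms(2)] unfolding representation_def by simp

locale tensor_homomorphism =
  S: tensor_factors C A + T: tensor_factors C' A' for C :: "'c cstar" and A :: "'a cstar" and C' :: "'c cstar" and A' :: "'a cstar" +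
  fixes g h
  assumes g: "g \<in> unital_star_hom C C'" and h: "h \<in> unital_star_hom A A'"
begin

lemma formal_map: "S.formal t \<Longrightarrow> T.formal (map (map_prod g h) t)"
  using unital_star_homD(1)[OF g] unital_star_homD(1)[OF h] by auto

lemma min_norm_map:
  assumes "S.formal t"
  shows "min_norm C' A' (map (map_prod g h) t) \<le> min_norm C A t"
proof (rule T.min_norm_le)
  show "0 \<le> min_norm C A t" by (rule S.min_norm_nonneg[OF assms])
  fix \<pi> \<rho> and vs :: "(('c \<Rightarrow> complex) \<times> ('a \<Rightarrow> complex)) list"
  assume "tensor_representation C' A' \<pi> \<rho>" and vs: "set vs \<subseteq> ell2 \<times> ell2"
  then interpret tensor_representation C' A' \<pi> \<rho> by simp
  interpret p: tensor_representation C A "\<pi> \<circ> g" "\<rho> \<circ> h"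
    by unfold_locales (rule representation_pullback[OF \<pi> g] representation_pullback[OF \<rho> h])+
  show "ell2_norm (tensor_vec (tensor_action \<pi> \<rho> (map (map_prod g h) t) vs))
      \<le> min_norm C A t * ell2_norm (tensor_vec vs)"
    unfolding tensor_action_map by (rule p.act_le_min_norm[OF assms vs])
qed

lemma map_smult:
  "S.formal t \<Longrightarrow> map (map_prod g h) (tensor_smult C z t) = tensor_smult C' z (map (map_prod g h) t)"
  using unital_star_homD(5)[OF g] by (auto simp: tensor_smult_def)

lemma map_star:
  "S.formal t \<Longrightarrow> map (map_prod g h) (tensor_star C A t) = tensor_star C' A' (map (map_prod g h) t)"
  using unital_star_homD(6)[OF g] unital_star_homD(6)[OF h] by (auto simp: tensor_star_def)

lemma map_mult:
  assumes "S.formal s" "S.formal t"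
  shows "map (map_prod g h) (tensor_mult C A s t) =
    tensor_mult C' A' (map (map_prod g h) s) (map (map_prod g h) t)"
  using assms(1)
proof (induction s)
  case (Cons x s)
  then show ?case using assms(2) unital_star_homD(3)[OF g] unital_star_homD(3)[OF h]
    by (cases x) (auto simp: tensor_mult_def)
qed (simp add: tensor_mult_def)

lemma tensor_dist_map:
  assumes "S.formal s" "S.formal t"
  shows "tensor_dist C' A' (map (map_prod g h) s) (map (map_prod g h) t) \<le> 1 * tensor_dist C A s t"
  using min_norm_map[OF S.formal_diff[OF assms, of "- 1"]] map_smult[OF assms(2)]
  by (simp add: tensor_dist_def)

lemma tensor_hom_class:
  assumes X: "X \<in> tensor_cauchy C A"
  shows "(\<lambda>n. map (map_prod g h) (X n)) \<in> tensor_cauchy C' A'"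
    and "tensor_hom C A C' A' g h (tensor_class C A X) = tensor_class C' A' (\<lambda>n. map (map_prod g h) (X n))"
  using S.lipschitz_lift[OF T.tensor_factors_axioms zero_le_one formal_map tensor_dist_map X]
    S.tensor_class_closed[OF X] by (simp_all add: tensor_hom_def)

lemma tensor_hom_unital_star_hom:
  "tensor_hom C A C' A' g h \<in> unital_star_hom (min_tensor C A) (min_tensor C' A')"
proof (rule unital_star_homI)
  let ?F = "tensor_hom C A C' A' g h"
  note f = S.tensor_cauchy_formal
  show "?F x \<in> carrier (min_tensor C' A')" if "x \<in> carrier (min_tensor C A)" for x
    using that by (elim S.tensor_carrierE) (simp add: tensor_hom_class T.tensor_class_closed)
  show "?F (x \<oplus>\<^bsub>min_tensor C A\<^esub> y) = ?F x \<oplus>\<^bsub>min_tensor C' A'\<^esub> ?F y"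
    if "x \<in> carrier (min_tensor C A)" "y \<in> carrier (min_tensor C A)" for x y
    using that by (elim S.tensor_carrierE)
      (simp add: tensor_hom_class S.tensor_add_class T.tensor_add_class)
  show "?F (x \<otimes>\<^bsub>min_tensor C A\<^esub> y) = ?F x \<otimes>\<^bsub>min_tensor C' A'\<^esub> ?F y"
    if "x \<in> carrier (min_tensor C A)" "y \<in> carrier (min_tensor C A)" for x y
    using that by (elim S.tensor_carrierE)
      (simp add: tensor_hom_class S.tensor_mult_class T.tensor_mult_class map_mult f)
  show "?F (z \<odot>\<^bsub>min_tensor C A\<^esub> x) = z \<odot>\<^bsub>min_tensor C' A'\<^esub> ?F x"
    if "x \<in> carrier (min_tensor C A)" for z x
    using that by (elim S.tensor_carrierE)
      (simp add: tensor_hom_class S.tensor_smult_class T.tensor_smult_class map_smult f)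
  show "?F (star (min_tensor C A) x) = star (min_tensor C' A') (?F x)"
    if "x \<in> carrier (min_tensor C A)" for x
    using that by (elim S.tensor_carrierE)
      (simp add: tensor_hom_class S.tensor_star_class T.tensor_star_class map_star f)
  have "S.formal [(\<one>\<^bsub>C\<^esub>, \<one>\<^bsub>A\<^esub>)]"
    by (simp add: unital_cstar_algebra_closed(3)[OF S.C] unital_cstar_algebra_closed(3)[OF S.A])
  from tensor_hom_class(2)[OF S.constant_cauchy[OF this]]
  show "?F \<one>\<^bsub>min_tensor C A\<^esub> = \<one>\<^bsub>min_tensor C' A'\<^esub>"
    by (simp add: min_tensor_def unital_star_homD(4)[OF g] unital_star_homD(4)[OF h])
  show "?F \<in> extensional (carrier (min_tensor C A))"
    by (simp add: tensor_hom_def)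
qed

end

lemma tensor_homomorphismI:
  assumes "unital_cstar_algebra C" "unital_cstar_algebra A" "unital_cstar_algebra C'" "unital_cstar_algebra A'"
    "g \<in> unital_star_hom C C'" "h \<in> unital_star_hom A A'"
  shows "tensor_homomorphism C A C' A' g h"
  using assms
  by (intro tensor_homomorphism.intro tensor_factors.intro tensor_homomorphism_axioms.intro)

lemma tensor_hom_compose:
  fixes C C' C'' :: "'c cstar" and A A' A'' :: "'a cstar"
  assumes "unital_cstar_algebra C" "unital_cstar_algebra A" "unital_cstar_algebra C'" "unital_cstar_algebra A'"
    "unital_cstar_algebra C''" "unital_cstar_algebra A''"
    and g: "g \<in> unital_star_hom C C'" and h: "h \<in> unital_star_hom A A'"
    and g': "g' \<in> unital_star_hom C' C''" and h': "h' \<in> unital_star_hom A' A''"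
    and x: "x \<in> carrier (min_tensor C A)"
  shows "tensor_hom C' A' C'' A'' g' h' (tensor_hom C A C' A' g h x) =
    tensor_hom C A C'' A'' (compose (carrier C) g' g) (compose (carrier A) h' h) x"
proof -
  interpret F: tensor_homomorphism C A C' A' g h using assms by (intro tensor_homomorphismI)
  interpret G: tensor_homomorphism C' A' C'' A'' g' h' using assms by (intro tensor_homomorphismI)
  interpret H: tensor_homomorphism C A C'' A'' "compose (carrier C) g' g" "compose (carrier A) h' h"
    using assms by (intro tensor_homomorphismI unital_star_hom_compose)
  obtain X where X: "X \<in> tensor_cauchy C A" "x = tensor_class C A X"
    using x by (rule F.S.tensor_carrierE)
  have "map (map_prod g' h') (map (map_prod g h) (X n)) =
      map (map_prod (compose (carrier C) g' g) (compose (carrier A) h' h)) (X n)" for n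
    using F.S.tensor_cauchy_formal[OF X(1), of n] by (auto simp: compose_eq)
  then show ?thesis
    unfolding X(2) F.tensor_hom_class(2)[OF X(1)] G.tensor_hom_class(2)[OF F.tensor_hom_class(1)[OF X(1)]]
      H.tensor_hom_class(2)[OF X(1)] by (simp only:)
qed


lemma compose_id_left: "f \<in> unital_star_hom A B \<Longrightarrow> compose (carrier A) (id_hom B) f = f"
  using unital_star_homD[of f A B] by (intro extensionalityI[of _ "carrier A"]) (auto simp: compose_def id_hom_def)

lemma compose_id_right: "f \<in> unital_star_hom A B \<Longrightarrow> compose (carrier A) f (id_hom A) = f"
  using unital_star_homD[of f A B] by (intro extensionalityI[of _ "carrier A"]) (auto simp: compose_def id_hom_def)

section \<open>The functor \<open>\<MM>\<close>\<close>

locale universal_quantum_families =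
  fixes M :: "'u cstar \<Rightarrow> 'u cstar \<Rightarrow> 'u cstar"
    and P :: "'u cstar \<Rightarrow> 'u cstar \<Rightarrow> 'u \<Rightarrow> (nat \<Rightarrow> ('u \<times> 'u) list) set"
  assumes M_fg: "B \<in> cstar_fg \<Longrightarrow> C \<in> cstar_fd \<Longrightarrow> M B C \<in> cstar_fg"
    and universal: "B \<in> cstar_fg \<Longrightarrow> C \<in> cstar_fd \<Longrightarrow>
      quantum_family_of_all_morphisms B C (M B C) (P B C)"
begin

lemma fg_algebra: "B \<in> cstar_fg \<Longrightarrow> unital_cstar_algebra B"
  by (simp add: cstar_fg_def)

lemma fd_algebra: "C \<in> cstar_fd \<Longrightarrow> unital_cstar_algebra C"
  by (simp add: cstar_fd_def cstar_fg_def)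

lemma M_algebra: "B \<in> cstar_fg \<Longrightarrow> C \<in> cstar_fd \<Longrightarrow> unital_cstar_algebra (M B C)"
  by (simp add: fg_algebra M_fg)

lemma P_hom: "B \<in> cstar_fg \<Longrightarrow> C \<in> cstar_fd \<Longrightarrow> P B C \<in> unital_star_hom B (min_tensor C (M B C))"
  using universal[of B C] by (simp add: quantum_family_of_all_morphisms_def quantum_family_def)

text \<open>
  The universal property of \<open>(B\<^sub>1, C\<^sub>1)\<close> applied to the quantum family \<open>(g \<otimes> id) P\<^sub>2 f\<close>.
\<close>

lemma induced_morphism_unique:
  assumes B: "B\<^sub>1 \<in> cstar_fg" "B\<^sub>2 \<in> cstar_fg" and C: "C\<^sub>1 \<in> cstar_fd" "C\<^sub>2 \<in> cstar_fd"
    and f: "f \<in> unital_star_hom B\<^sub>1 B\<^sub>2" and g: "g \<in> unital_star_hom C\<^sub>2 C\<^sub>1"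
  shows "\<exists>!\<Lambda>. \<Lambda> \<in> unital_star_hom (M B\<^sub>1 C\<^sub>1) (M B\<^sub>2 C\<^sub>2) \<and>
        compose (carrier B\<^sub>1)
          (tensor_hom C\<^sub>1 (M B\<^sub>1 C\<^sub>1) C\<^sub>1 (M B\<^sub>2 C\<^sub>2) (id_hom C\<^sub>1) \<Lambda>) (P B\<^sub>1 C\<^sub>1) =
        compose (carrier B\<^sub>1)
          (tensor_hom C\<^sub>2 (M B\<^sub>2 C\<^sub>2) C\<^sub>1 (M B\<^sub>2 C\<^sub>2) g (id_hom (M B\<^sub>2 C\<^sub>2)))
          (compose (carrier B\<^sub>1) (P B\<^sub>2 C\<^sub>2) f)"
proof -
  interpret tensor_homomorphism C\<^sub>2 "M B\<^sub>2 C\<^sub>2" C\<^sub>1 "M B\<^sub>2 C\<^sub>2" g "id_hom (M B\<^sub>2 C\<^sub>2)"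
    using B C g by (intro tensor_homomorphismI fd_algebra M_algebra unital_star_hom_id)
  have "compose (carrier B\<^sub>1)
          (tensor_hom C\<^sub>2 (M B\<^sub>2 C\<^sub>2) C\<^sub>1 (M B\<^sub>2 C\<^sub>2) g (id_hom (M B\<^sub>2 C\<^sub>2)))
          (compose (carrier B\<^sub>1) (P B\<^sub>2 C\<^sub>2) f) \<in> unital_star_hom B\<^sub>1 (min_tensor C\<^sub>1 (M B\<^sub>2 C\<^sub>2))"
    by (rule unital_star_hom_compose[OF fg_algebra[OF B(1)]
          unital_star_hom_compose[OF fg_algebra[OF B(1)] f P_hom[OF B(2) C(2)]] tensor_hom_unital_star_hom])
  then have "quantum_family B\<^sub>1 C\<^sub>1 (M B\<^sub>2 C\<^sub>2) (compose (carrier B\<^sub>1)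
          (tensor_hom C\<^sub>2 (M B\<^sub>2 C\<^sub>2) C\<^sub>1 (M B\<^sub>2 C\<^sub>2) g (id_hom (M B\<^sub>2 C\<^sub>2)))
          (compose (carrier B\<^sub>1) (P B\<^sub>2 C\<^sub>2) f))"
    using M_algebra[OF B(2) C(2)] by (simp add: quantum_family_def)
  then show ?thesis
    using universal[OF B(1) C(1)] unfolding quantum_family_of_all_morphisms_def by blast
qed

lemma induced_morphism_hom:
  assumes "B\<^sub>1 \<in> cstar_fg" "B\<^sub>2 \<in> cstar_fg" "C\<^sub>1 \<in> cstar_fd" "C\<^sub>2 \<in> cstar_fd"
    and "f \<in> unital_star_hom B\<^sub>1 B\<^sub>2" "g \<in> unital_star_hom C\<^sub>2 C\<^sub>1"
  shows "induced_morphism M P B\<^sub>1 C\<^sub>1 B\<^sub>2 C\<^sub>2 f g \<in> unital_star_hom (M B\<^sub>1 C\<^sub>1) (M B\<^sub>2 C\<^sub>2)"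
  using theI'[OF induced_morphism_unique[OF assms]] unfolding induced_morphism_def by blast

lemma induced_morphism_intertwines:
  assumes "B\<^sub>1 \<in> cstar_fg" "B\<^sub>2 \<in> cstar_fg" "C\<^sub>1 \<in> cstar_fd" "C\<^sub>2 \<in> cstar_fd"
    and "f \<in> unital_star_hom B\<^sub>1 B\<^sub>2" "g \<in> unital_star_hom C\<^sub>2 C\<^sub>1" and b: "b \<in> carrier B\<^sub>1"
  shows "tensor_hom C\<^sub>1 (M B\<^sub>1 C\<^sub>1) C\<^sub>1 (M B\<^sub>2 C\<^sub>2) (id_hom C\<^sub>1) (induced_morphism M P B\<^sub>1 C\<^sub>1 B\<^sub>2 C\<^sub>2 f g) (P B\<^sub>1 C\<^sub>1 b) =
    tensor_hom C\<^sub>2 (M B\<^sub>2 C\<^sub>2) C\<^sub>1 (M B\<^sub>2 C\<^sub>2) g (id_hom (M B\<^sub>2 C\<^sub>2)) (P B\<^sub>2 C\<^sub>2 (f b))"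
proof -
  have "compose (carrier B\<^sub>1)
          (tensor_hom C\<^sub>1 (M B\<^sub>1 C\<^sub>1) C\<^sub>1 (M B\<^sub>2 C\<^sub>2) (id_hom C\<^sub>1) (induced_morphism M P B\<^sub>1 C\<^sub>1 B\<^sub>2 C\<^sub>2 f g)) (P B\<^sub>1 C\<^sub>1) =
        compose (carrier B\<^sub>1)
          (tensor_hom C\<^sub>2 (M B\<^sub>2 C\<^sub>2) C\<^sub>1 (M B\<^sub>2 C\<^sub>2) g (id_hom (M B\<^sub>2 C\<^sub>2)))
          (compose (carrier B\<^sub>1) (P B\<^sub>2 C\<^sub>2) f)"
    using theI'[OF induced_morphism_unique[OF assms(1-6)]] unfolding induced_morphism_def by blast
  from fun_cong[OF this, of b] show ?thesis using b by (simp add: compose_eq)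
qed

lemma induced_morphism_eqI:
  assumes "B\<^sub>1 \<in> cstar_fg" "B\<^sub>2 \<in> cstar_fg" "C\<^sub>1 \<in> cstar_fd" "C\<^sub>2 \<in> cstar_fd"
    and "f \<in> unital_star_hom B\<^sub>1 B\<^sub>2" "g \<in> unital_star_hom C\<^sub>2 C\<^sub>1"
    and \<Lambda>: "\<Lambda> \<in> unital_star_hom (M B\<^sub>1 C\<^sub>1) (M B\<^sub>2 C\<^sub>2)"
    and eq: "\<And>b. b \<in> carrier B\<^sub>1 \<Longrightarrow>
      tensor_hom C\<^sub>1 (M B\<^sub>1 C\<^sub>1) C\<^sub>1 (M B\<^sub>2 C\<^sub>2) (id_hom C\<^sub>1) \<Lambda> (P B\<^sub>1 C\<^sub>1 b) =
      tensor_hom C\<^sub>2 (M B\<^sub>2 C\<^sub>2) C\<^sub>1 (M B\<^sub>2 C\<^sub>2) g (id_hom (M B\<^sub>2 C\<^sub>2)) (P B\<^sub>2 C\<^sub>2 (f b))"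
  shows "induced_morphism M P B\<^sub>1 C\<^sub>1 B\<^sub>2 C\<^sub>2 f g = \<Lambda>"
proof -
  have "compose (carrier B\<^sub>1)
          (tensor_hom C\<^sub>1 (M B\<^sub>1 C\<^sub>1) C\<^sub>1 (M B\<^sub>2 C\<^sub>2) (id_hom C\<^sub>1) \<Lambda>) (P B\<^sub>1 C\<^sub>1) =
        compose (carrier B\<^sub>1)
          (tensor_hom C\<^sub>2 (M B\<^sub>2 C\<^sub>2) C\<^sub>1 (M B\<^sub>2 C\<^sub>2) g (id_hom (M B\<^sub>2 C\<^sub>2)))
          (compose (carrier B\<^sub>1) (P B\<^sub>2 C\<^sub>2) f)"
    using eq by (auto simp: compose_def fun_eq_iff)
  then show ?thesis
    unfolding induced_morphism_def
    using the1_equality[OF induced_morphism_unique[OF assms(1-6)]] \<Lambda> by blast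
qed

lemma induced_morphism_id:
  assumes B: "B \<in> cstar_fg" and C: "C \<in> cstar_fd"
  shows "induced_morphism M P B C B C (id_hom B) (id_hom C) = id_hom (M B C)"
  using assms
  by (intro induced_morphism_eqI unital_star_hom_id fg_algebra fd_algebra M_algebra) (simp_all add: id_hom_def)

text \<open>
  Besides the two intertwining relations, the computation uses that \<open>id \<otimes> N\<close> commutes with
  \<open>g \<otimes> id\<close>, both composites being \<open>g \<otimes> N\<close>.
\<close>

lemma induced_morphism_compose:
  assumes B: "B\<^sub>1 \<in> cstar_fg" "B\<^sub>2 \<in> cstar_fg" "B\<^sub>3 \<in> cstar_fg"
    and C: "C\<^sub>1 \<in> cstar_fd" "C\<^sub>2 \<in> cstar_fd" "C\<^sub>3 \<in> cstar_fd"
    and f: "f \<in> unital_star_hom B\<^sub>1 B\<^sub>2" and f': "f' \<in> unital_star_hom B\<^sub>2 B\<^sub>3"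
    and g: "g \<in> unital_star_hom C\<^sub>2 C\<^sub>1" and g': "g' \<in> unital_star_hom C\<^sub>3 C\<^sub>2"
  shows "induced_morphism M P B\<^sub>1 C\<^sub>1 B\<^sub>3 C\<^sub>3 (compose (carrier B\<^sub>1) f' f) (compose (carrier C\<^sub>3) g g') =
    compose (carrier (M B\<^sub>1 C\<^sub>1))
      (induced_morphism M P B\<^sub>2 C\<^sub>2 B\<^sub>3 C\<^sub>3 f' g') (induced_morphism M P B\<^sub>1 C\<^sub>1 B\<^sub>2 C\<^sub>2 f g)"
proof -
  define K where "K = induced_morphism M P B\<^sub>1 C\<^sub>1 B\<^sub>2 C\<^sub>2 f g"
  define N where "N = induced_morphism M P B\<^sub>2 C\<^sub>2 B\<^sub>3 C\<^sub>3 f' g'"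
  let ?M1 = "M B\<^sub>1 C\<^sub>1" and ?M2 = "M B\<^sub>2 C\<^sub>2" and ?M3 = "M B\<^sub>3 C\<^sub>3"
  note alg = fd_algebra[OF C(1)] fd_algebra[OF C(2)] fd_algebra[OF C(3)]
    M_algebra[OF B(1) C(1)] M_algebra[OF B(2) C(2)] M_algebra[OF B(3) C(3)]
  note ids = unital_star_hom_id[OF alg(1)] unital_star_hom_id[OF alg(2)] unital_star_hom_id[OF alg(3)]
    unital_star_hom_id[OF alg(5)] unital_star_hom_id[OF alg(6)]
  have K: "K \<in> unital_star_hom ?M1 ?M2" unfolding K_def using B C f g by (intro induced_morphism_hom)
  have N: "N \<in> unital_star_hom ?M2 ?M3" unfolding N_def using B C f' g' by (intro induced_morphism_hom)
  have "induced_morphism M P B\<^sub>1 C\<^sub>1 B\<^sub>3 C\<^sub>3 (compose (carrier B\<^sub>1) f' f) (compose (carrier C\<^sub>3) g g') =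
    compose (carrier ?M1) N K"
  proof (rule induced_morphism_eqI)
    show "compose (carrier B\<^sub>1) f' f \<in> unital_star_hom B\<^sub>1 B\<^sub>3"
      by (rule unital_star_hom_compose[OF fg_algebra[OF B(1)] f f'])
    show "compose (carrier C\<^sub>3) g g' \<in> unital_star_hom C\<^sub>3 C\<^sub>1"
      by (rule unital_star_hom_compose[OF alg(3) g' g])
    show "compose (carrier ?M1) N K \<in> unital_star_hom ?M1 ?M3"
      by (rule unital_star_hom_compose[OF alg(4) K N])
    fix b assume b: "b \<in> carrier B\<^sub>1"
    have fb: "f b \<in> carrier B\<^sub>2" using unital_star_homD(1)[OF f b] .
    have ffb: "f' (f b) \<in> carrier B\<^sub>3" using unital_star_homD(1)[OF f' fb] .
    note p = unital_star_homD(1)[OF P_hom[OF B(1) C(1)] b]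
      unital_star_homD(1)[OF P_hom[OF B(2) C(2)] fb] unital_star_homD(1)[OF P_hom[OF B(3) C(3)] ffb]
    have "tensor_hom C\<^sub>1 ?M1 C\<^sub>1 ?M3 (id_hom C\<^sub>1) (compose (carrier ?M1) N K) (P B\<^sub>1 C\<^sub>1 b) =
      tensor_hom C\<^sub>1 ?M2 C\<^sub>1 ?M3 (id_hom C\<^sub>1) N (tensor_hom C\<^sub>1 ?M1 C\<^sub>1 ?M2 (id_hom C\<^sub>1) K (P B\<^sub>1 C\<^sub>1 b))"
      using tensor_hom_compose[OF alg(1,4) alg(1,5) alg(1,6) ids(1) K ids(1) N p(1)]
      by (simp add: compose_id_left[OF ids(1)])
    also have "\<dots> = tensor_hom C\<^sub>1 ?M2 C\<^sub>1 ?M3 (id_hom C\<^sub>1) N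
        (tensor_hom C\<^sub>2 ?M2 C\<^sub>1 ?M2 g (id_hom ?M2) (P B\<^sub>2 C\<^sub>2 (f b)))"
      unfolding K_def using induced_morphism_intertwines[OF B(1,2) C(1,2) f g b] by simp
    also have "\<dots> = tensor_hom C\<^sub>2 ?M2 C\<^sub>1 ?M3 g N (P B\<^sub>2 C\<^sub>2 (f b))"
      using tensor_hom_compose[OF alg(2,5) alg(1,5) alg(1,6) g ids(4) ids(1) N p(2)]
      by (simp add: compose_id_left[OF g] compose_id_right[OF N])
    also have "\<dots> = tensor_hom C\<^sub>2 ?M3 C\<^sub>1 ?M3 g (id_hom ?M3)
        (tensor_hom C\<^sub>2 ?M2 C\<^sub>2 ?M3 (id_hom C\<^sub>2) N (P B\<^sub>2 C\<^sub>2 (f b)))"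
      using tensor_hom_compose[OF alg(2,5) alg(2,6) alg(1,6) ids(2) N g ids(5) p(2)]
      by (simp add: compose_id_right[OF g] compose_id_left[OF N])
    also have "\<dots> = tensor_hom C\<^sub>2 ?M3 C\<^sub>1 ?M3 g (id_hom ?M3)
        (tensor_hom C\<^sub>3 ?M3 C\<^sub>2 ?M3 g' (id_hom ?M3) (P B\<^sub>3 C\<^sub>3 (f' (f b))))"
      unfolding N_def using induced_morphism_intertwines[OF B(2,3) C(2,3) f' g' fb] by simp
    also have "\<dots> = tensor_hom C\<^sub>3 ?M3 C\<^sub>1 ?M3 (compose (carrier C\<^sub>3) g g') (id_hom ?M3) (P B\<^sub>3 C\<^sub>3 (f' (f b)))"
      using tensor_hom_compose[OF alg(3,6) alg(2,6) alg(1,6) g' ids(5) g ids(5) p(3)]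
      by (simp add: compose_id_left[OF ids(5)])
    finally show "tensor_hom C\<^sub>1 ?M1 C\<^sub>1 ?M3 (id_hom C\<^sub>1) (compose (carrier ?M1) N K) (P B\<^sub>1 C\<^sub>1 b) =
      tensor_hom C\<^sub>3 ?M3 C\<^sub>1 ?M3 (compose (carrier C\<^sub>3) g g') (id_hom ?M3)
        (P B\<^sub>3 C\<^sub>3 (compose (carrier B\<^sub>1) f' f b))"
      using b by (simp add: compose_eq)
  qed (use B C in simp_all)
  then show ?thesis by (simp add: K_def N_def)
qed

end

theorem mainTheorem1:
  fixes M :: "'u cstar \<Rightarrow> 'u cstar \<Rightarrow> 'u cstar"
    and P :: "'u cstar \<Rightarrow> 'u cstar \<Rightarrow> 'u \<Rightarrow> (nat \<Rightarrow> ('u \<times> 'u) list) set"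
  assumes "\<And>B C. B \<in> cstar_fg \<Longrightarrow> C \<in> cstar_fd \<Longrightarrow>
             M B C \<in> cstar_fg \<and> quantum_family_of_all_morphisms B C (M B C) (P B C)"
  shows "(\<forall>B\<in>cstar_fg. \<forall>C\<in>cstar_fd. M B C \<in> cstar_fg) \<and>
    (\<forall>B\<^sub>1\<in>cstar_fg. \<forall>B\<^sub>2\<in>cstar_fg. \<forall>C\<^sub>1\<in>cstar_fd. \<forall>C\<^sub>2\<in>cstar_fd.
       \<forall>f\<in>unital_star_hom B\<^sub>1 B\<^sub>2. \<forall>g\<in>unital_star_hom C\<^sub>2 C\<^sub>1.
         induced_morphism M P B\<^sub>1 C\<^sub>1 B\<^sub>2 C\<^sub>2 f g \<in> unital_star_hom (M B\<^sub>1 C\<^sub>1) (M B\<^sub>2 C\<^sub>2)) \<and>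
    (\<forall>B\<in>cstar_fg. \<forall>C\<in>cstar_fd.
       induced_morphism M P B C B C (id_hom B) (id_hom C) = id_hom (M B C)) \<and>
    (\<forall>B\<^sub>1\<in>cstar_fg. \<forall>B\<^sub>2\<in>cstar_fg. \<forall>B\<^sub>3\<in>cstar_fg.
     \<forall>C\<^sub>1\<in>cstar_fd. \<forall>C\<^sub>2\<in>cstar_fd. \<forall>C\<^sub>3\<in>cstar_fd.
       \<forall>f\<in>unital_star_hom B\<^sub>1 B\<^sub>2. \<forall>f'\<in>unital_star_hom B\<^sub>2 B\<^sub>3.
       \<forall>g\<in>unital_star_hom C\<^sub>2 C\<^sub>1. \<forall>g'\<in>unital_star_hom C\<^sub>3 C\<^sub>2.
         induced_morphism M P B\<^sub>1 C\<^sub>1 B\<^sub>3 C\<^sub>3 (compose (carrier B\<^sub>1) f' f) (compose (carrier C\<^sub>3) g g') =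
         compose (carrier (M B\<^sub>1 C\<^sub>1))
           (induced_morphism M P B\<^sub>2 C\<^sub>2 B\<^sub>3 C\<^sub>3 f' g')
           (induced_morphism M P B\<^sub>1 C\<^sub>1 B\<^sub>2 C\<^sub>2 f g))"
proof -
  interpret universal_quantum_families M P using assms by unfold_locales auto
  show ?thesis
    by (intro conjI ballI M_fg induced_morphism_hom induced_morphism_id induced_morphism_compose)
qed

end
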